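(* Let $m\ge 2$. There is a homomorphism $\phi:\tilde{y}(m)\to SO(V,q)$ defined on generators by \[ \tau\mapsto r_u,\qquad a\mapsto r_u r_{v_1},\qquad \tilde{s}_i\mapsto r_{v_i+v_{i+1}}\quad (1\le i\le m-1). \]
   Context: Conventions: $x^y=y^{-1}xy$, $[x,y]=x^{-1}y^{-1}xy$. $S_m$ is the symmetric group on $\{1,\dots,m\}$ and $s_i=(i,i+1)$. The group $y(m)=\langle a, S_m \mid [s_1,s_1^{a^k}]=1 \text{ for all } k\in\mathbb{Z},\ a^{s_i}=a^{-1} \text{ for } 2\le i\le m-1\rangle$ (quotient of the free product of $\langle a\rangle\cong\mathbb{Z}$ and $S_m$). $\tilde{y}(m)=y(m)\langle\tau\rangle$ is the semidirect product with an involution $\tau$ acting on $y(m)$ by inverting $a$ and centralising $S_m$. Put $\tilde{s}_i=\tau s_i$. $R=\mathbb{F}_2[t,t^{-1}]$ with $t$ an indeterminate. $V$ is the free $R$-module with basis $u,v_1,\dots,v_m$. The symplectic (alternating) bilinear form $(\cdot,\cdot)$ on $V$ is given by $(u,v_i)=(v_i,v_j)=1$ for all $i$ and all $j\neq i$, and $q$ is the quadratic form with associated bilinear form $(\cdot,\cdot)$ (so $q(x+y)=q(x)+q(y)+(x,y)$) and $q(u)=1$, $q(v_1)=\dots=q(v_m)=t^{-1}$. In particular $q(v_i+v_j)=1$ for $i\ne j$. $SO(V,q)=GO(V,q)$ is the group of $R$-module automorphisms of $V$ preserving $q$; maps are composed left to right (acting on the right). For $w\in V$ with $q(w)$ invertible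 in $R$, $r_w$ is the orthogonal transvection $r_w(x)=x+\frac{(x,w)}{q(w)}w$. *)

theory Defs
  imports
    "HOL-Algebra.Sym_Groups"
    "HOL-Algebra.Elementary_Groups"
    "HOL-Algebra.Bij"
    "HOL-Library.Z2"
    "HOL-Library.Poly_Mapping"
    "HOL-Library.Function_Algebras"
begin

section \<open>Free products, normal closures and semidirect products\<close>

text \<open>
  The elements of the free product of \<open>G\<close> and \<open>H\<close> are classes of words with letters from both
  carriers, modulo the congruence generated by the two multiplication tables.
\<close>

abbreviation fp_words ::
    "('a, 'c) monoid_scheme \<Rightarrow> ('b, 'd) monoid_scheme \<Rightarrow> ('a + 'b) list set"
  where "fp_words G H \<equiv> lists (carrier G <+> carrier H)"

inductive fp_eq ::
    "('a, 'c) monoid_scheme \<Rightarrow> ('b, 'd) monoid_scheme \<Rightarrow> ('a + 'b) list \<Rightarrow> ('a + 'b) list \<Rightarrow> bool"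
  for G (structure) and H (structure)
  where
    fp_refl: "w \<in> fp_words G H \<Longrightarrow> fp_eq G H w w"
  | fp_sym: "fp_eq G H w w' \<Longrightarrow> fp_eq G H w' w"
  | fp_trans: "fp_eq G H w w' \<Longrightarrow> fp_eq G H w' w'' \<Longrightarrow> fp_eq G H w w''"
  | fp_multL: "\<lbrakk>us \<in> fp_words G H; vs \<in> fp_words G H; x \<in> carrier G; y \<in> carrier G\<rbrakk>
      \<Longrightarrow> fp_eq G H (us @ [Inl x, Inl y] @ vs) (us @ [Inl (x \<otimes>\<^bsub>G\<^esub> y)] @ vs)"
  | fp_multR: "\<lbrakk>us \<in> fp_words G H; vs \<in> fp_words G H; x \<in> carrier H; y \<in> carrier H\<rbrakk>
      \<Longrightarrow> fp_eq G H (us @ [Inr x, Inr y] @ vs) (us @ [Inr (x \<otimes>\<^bsub>H\<^esub> y)] @ vs)"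
  | fp_oneL: "\<lbrakk>us \<in> fp_words G H; vs \<in> fp_words G H\<rbrakk>
      \<Longrightarrow> fp_eq G H (us @ [Inl \<one>\<^bsub>G\<^esub>] @ vs) (us @ vs)"
  | fp_oneR: "\<lbrakk>us \<in> fp_words G H; vs \<in> fp_words G H\<rbrakk>
      \<Longrightarrow> fp_eq G H (us @ [Inr \<one>\<^bsub>H\<^esub>] @ vs) (us @ vs)"

definition fp_class ::
    "('a, 'c) monoid_scheme \<Rightarrow> ('b, 'd) monoid_scheme \<Rightarrow> ('a + 'b) list \<Rightarrow> ('a + 'b) list set"
  where "fp_class G H w = {w'. fp_eq G H w w'}"

definition free_product ::
    "('a, 'c) monoid_scheme \<Rightarrow> ('b, 'd) monoid_scheme \<Rightarrow> ('a + 'b) list set monoid"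
  where "free_product G H =
    \<lparr>carrier = fp_class G H ` fp_words G H,
     mult = (\<lambda>A B. \<Union>a\<in>A. \<Union>b\<in>B. fp_class G H (a @ b)),
     one = fp_class G H []\<rparr>"

definition normal_closure :: "('a, 'b) monoid_scheme \<Rightarrow> 'a set \<Rightarrow> 'a set"
  where "normal_closure G R = carrier G \<inter> \<Inter>{N. N \<lhd> G \<and> R \<subseteq> N}"

text \<open>The pair \<open>(n, h)\<close> stands for the product \<open>n h\<close>, and \<open>\<alpha> h n\<close> for \<open>h n h inv(h)\<close>.\<close>

definition semidirect ::
    "('a, 'c) monoid_scheme \<Rightarrow> ('b, 'd) monoid_scheme \<Rightarrow> ('b \<Rightarrow> 'a \<Rightarrow> 'a) \<Rightarrow> ('a \<times> 'b) monoid"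
  where "semidirect N H \<alpha> =
    \<lparr>carrier = carrier N \<times> carrier H,
     mult = (\<lambda>(n, h) (n', h'). (n \<otimes>\<^bsub>N\<^esub> \<alpha> h n', h \<otimes>\<^bsub>H\<^esub> h')),
     one = (\<one>\<^bsub>N\<^esub>, \<one>\<^bsub>H\<^esub>)\<rparr>"

text \<open>The conventions are \<open>x^y = inv(y) x y\<close> and \<open>[x, y] = inv(x) inv(y) x y\<close>.\<close>

definition conj_by :: "('a, 'b) monoid_scheme \<Rightarrow> 'a \<Rightarrow> 'a \<Rightarrow> 'a"
  where "conj_by G x y = inv\<^bsub>G\<^esub> y \<otimes>\<^bsub>G\<^esub> x \<otimes>\<^bsub>G\<^esub> y"

definition commutator :: "('a, 'b) monoid_scheme \<Rightarrow> 'a \<Rightarrow> 'a \<Rightarrow> 'a"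
  where "commutator G x y = inv\<^bsub>G\<^esub> x \<otimes>\<^bsub>G\<^esub> inv\<^bsub>G\<^esub> y \<otimes>\<^bsub>G\<^esub> x \<otimes>\<^bsub>G\<^esub> y"

lemma fp_eq_words: "fp_eq G H w w' \<Longrightarrow> w \<in> fp_words G H \<and> w' \<in> fp_words G H"
  if "group G" "group H"
proof (induction rule: fp_eq.induct)
qed (use that in \<open>auto intro!: monoid.m_closed monoid.one_closed group.is_monoid\<close>)

lemma fp_eq_append1:
  assumes "fp_eq G H w w'" "v \<in> fp_words G H"
  shows "fp_eq G H (w @ v) (w' @ v)"
  using assms
proof (induction rule: fp_eq.induct)
  case (fp_multL us vs x y)
  then show ?case using fp_eq.fp_multL[of us G H "vs @ v" x y] by simp
next
  case (fp_multR us vs x y)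
  then show ?case using fp_eq.fp_multR[of us G H "vs @ v" x y] by simp
next
  case (fp_oneL us vs)
  then show ?case using fp_eq.fp_oneL[of us G H "vs @ v"] by simp
next
  case (fp_oneR us vs)
  then show ?case using fp_eq.fp_oneR[of us G H "vs @ v"] by simp
next
  case (fp_refl w)
  then show ?case by (intro fp_eq.fp_refl) simp
qed (blast intro: fp_eq.fp_sym fp_eq.fp_trans)+

lemma fp_eq_append2:
  assumes "fp_eq G H w w'" "v \<in> fp_words G H"
  shows "fp_eq G H (v @ w) (v @ w')"
  using assms
proof (induction rule: fp_eq.induct)
  case (fp_multL us vs x y)
  then show ?case using fp_eq.fp_multL[of "v @ us" G H vs x y] by simp
next
  case (fp_multR us vs x y)
  then show ?case using fp_eq.fp_multR[of "v @ us" G H vs x y] by simp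
next
  case (fp_oneL us vs)
  then show ?case using fp_eq.fp_oneL[of "v @ us" G H vs] by simp
next
  case (fp_oneR us vs)
  then show ?case using fp_eq.fp_oneR[of "v @ us" G H vs] by simp
next
  case (fp_refl w)
  then show ?case by (intro fp_eq.fp_refl) simp
qed (blast intro: fp_eq.fp_sym fp_eq.fp_trans)+

lemma fp_class_eq: "fp_eq G H w w' \<Longrightarrow> fp_class G H w = fp_class G H w'"
  unfolding fp_class_def by (blast intro: fp_eq.fp_sym fp_eq.fp_trans)

lemma fp_class_self: "w \<in> fp_words G H \<Longrightarrow> w \<in> fp_class G H w"
  unfolding fp_class_def by (simp add: fp_eq.fp_refl)

lemma carrier_free_product: "carrier (free_product G H) = fp_class G H ` fp_words G H"
  by (simp add: free_product_def)

lemma fp_class_closed: "w \<in> fp_words G H \<Longrightarrow> fp_class G H w \<in> carrier (free_product G H)"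
  unfolding carrier_free_product by (rule imageI)

lemma one_free_product: "\<one>\<^bsub>free_product G H\<^esub> = fp_class G H []"
  by (simp add: free_product_def)

lemma mult_free_product:
  assumes "group G" "group H" "w \<in> fp_words G H" "w' \<in> fp_words G H"
  shows "fp_class G H w \<otimes>\<^bsub>free_product G H\<^esub> fp_class G H w' = fp_class G H (w @ w')"
proof -
  have eq: "fp_class G H (a @ b) = fp_class G H (w @ w')"
    if "a \<in> fp_class G H w" "b \<in> fp_class G H w'" for a b
  proof -
    have ab: "fp_eq G H w a" "fp_eq G H w' b" using that by (auto simp: fp_class_def)
    have "fp_eq G H (w @ w') (a @ w')" using ab(1) assms(4) by (rule fp_eq_append1)
    moreover have "fp_eq G H (a @ w') (a @ b)"
      using ab fp_eq_words[OF assms(1,2) ab(1)] by (blast intro: fp_eq_append2)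
    ultimately show ?thesis using fp_class_eq by metis
  qed
  have ne: "fp_class G H w \<noteq> {}" "fp_class G H w' \<noteq> {}"
    using fp_class_self[OF assms(3)] fp_class_self[OF assms(4)] by blast+
  have "(\<Union>a\<in>fp_class G H w. \<Union>b\<in>fp_class G H w'. fp_class G H (a @ b))
      = (\<Union>a\<in>fp_class G H w. \<Union>b\<in>fp_class G H w'. fp_class G H (w @ w'))"
    by (intro SUP_cong refl eq)
  then show ?thesis
    using ne by (simp add: free_product_def)
qed

lemma fp_left_inverse:
  assumes G: "group G" and H: "group H" and w: "w \<in> fp_words G H"
  shows "\<exists>w' \<in> fp_words G H. fp_eq G H (w' @ w) []"
  using w
proof (induction w)
  case Nil
  show ?case by (intro bexI[of _ "[]"]) (auto intro: fp_eq.fp_refl)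
next
  case (Cons c w)
  then have w: "w \<in> fp_words G H" and c: "c \<in> carrier G <+> carrier H" by auto
  obtain w' where w': "w' \<in> fp_words G H" "fp_eq G H (w' @ w) []"
    using Cons.IH by blast
  interpret G: group G by (rule G)
  interpret H: group H by (rule H)
  have "\<exists>d. d \<in> carrier G <+> carrier H \<and> fp_eq G H ([] @ [d, c] @ w) ([] @ w)"
  proof (cases c)
    case (Inl x)
    then have x: "x \<in> carrier G" using c by auto
    have "fp_eq G H ([] @ [Inl (inv\<^bsub>G\<^esub> x), Inl x] @ w) ([] @ [Inl (inv\<^bsub>G\<^esub> x \<otimes>\<^bsub>G\<^esub> x)] @ w)"
      using w x by (intro fp_eq.fp_multL) auto
    also have "inv\<^bsub>G\<^esub> x \<otimes>\<^bsub>G\<^esub> x = \<one>\<^bsub>G\<^esub>" using x by simp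
    finally have "fp_eq G H ([] @ [Inl (inv\<^bsub>G\<^esub> x), Inl x] @ w) ([] @ w)"
      using w by (blast intro: fp_eq.fp_trans fp_eq.fp_oneL lists.Nil)
    then show ?thesis using x Inl by blast
  next
    case (Inr x)
    then have x: "x \<in> carrier H" using c by auto
    have "fp_eq G H ([] @ [Inr (inv\<^bsub>H\<^esub> x), Inr x] @ w) ([] @ [Inr (inv\<^bsub>H\<^esub> x \<otimes>\<^bsub>H\<^esub> x)] @ w)"
      using w x by (intro fp_eq.fp_multR) auto
    also have "inv\<^bsub>H\<^esub> x \<otimes>\<^bsub>H\<^esub> x = \<one>\<^bsub>H\<^esub>" using x by simp
    finally have "fp_eq G H ([] @ [Inr (inv\<^bsub>H\<^esub> x), Inr x] @ w) ([] @ w)"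
      using w by (blast intro: fp_eq.fp_trans fp_eq.fp_oneR lists.Nil)
    then show ?thesis using x Inr by blast
  qed
  then obtain d where d: "d \<in> carrier G <+> carrier H" "fp_eq G H ([d, c] @ w) w" by auto
  have "fp_eq G H (w' @ ([d, c] @ w)) (w' @ w)"
    using d(2) w'(1) by (rule fp_eq_append2)
  from fp_eq.fp_trans[OF this w'(2)] have "fp_eq G H ((w' @ [d]) @ (c # w)) []" by simp
  moreover have "w' @ [d] \<in> fp_words G H" using w' d by auto
  ultimately show ?case by blast
qed

lemma group_free_product:
  assumes G: "group G" and H: "group H"
  shows "group (free_product G H)"
proof (rule groupI)
  note m = mult_free_product[OF G H]
  have cE: "\<exists>w\<in>fp_words G H. x = fp_class G H w" if "x \<in> carrier (free_product G H)" for x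
    using that by (auto simp: carrier_free_product)
  have app: "w @ w' \<in> fp_words G H" if "w \<in> fp_words G H" "w' \<in> fp_words G H" for w w'
    using that by simp
  show "x \<otimes>\<^bsub>free_product G H\<^esub> y \<in> carrier (free_product G H)"
    if xy: "x \<in> carrier (free_product G H)" "y \<in> carrier (free_product G H)" for x y
    using cE[OF xy(1)] cE[OF xy(2)] m fp_class_closed app by metis
  show "\<one>\<^bsub>free_product G H\<^esub> \<in> carrier (free_product G H)"
    unfolding one_free_product by (intro fp_class_closed lists.Nil)
  show "x \<otimes>\<^bsub>free_product G H\<^esub> y \<otimes>\<^bsub>free_product G H\<^esub> z
      = x \<otimes>\<^bsub>free_product G H\<^esub> (y \<otimes>\<^bsub>free_product G H\<^esub> z)"
    if xyz: "x \<in> carrier (free_product G H)" "y \<in> carrier (free_product G H)"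
      "z \<in> carrier (free_product G H)" for x y z
  proof -
    obtain a b c where "a \<in> fp_words G H" "b \<in> fp_words G H" "c \<in> fp_words G H"
      "x = fp_class G H a" "y = fp_class G H b" "z = fp_class G H c"
      using cE[OF xyz(1)] cE[OF xyz(2)] cE[OF xyz(3)] by blast
    then show ?thesis by (simp only: m app append_assoc)
  qed
  show "\<one>\<^bsub>free_product G H\<^esub> \<otimes>\<^bsub>free_product G H\<^esub> x = x"
    if x: "x \<in> carrier (free_product G H)" for x
    using cE[OF x] m[OF lists.Nil] unfolding one_free_product by fastforce
  show "\<exists>y\<in>carrier (free_product G H). y \<otimes>\<^bsub>free_product G H\<^esub> x = \<one>\<^bsub>free_product G H\<^esub>"
    if x: "x \<in> carrier (free_product G H)" for x
  proof -
    obtain w where w: "w \<in> fp_words G H" "x = fp_class G H w"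
      using x by (auto simp: carrier_free_product)
    obtain w' where w': "w' \<in> fp_words G H" "fp_eq G H (w' @ w) []"
      using fp_left_inverse[OF G H w(1)] by blast
    have "fp_class G H w' \<otimes>\<^bsub>free_product G H\<^esub> x = \<one>\<^bsub>free_product G H\<^esub>"
      unfolding w(2) m[OF w'(1) w(1)] one_free_product by (rule fp_class_eq[OF w'(2)])
    then show ?thesis using fp_class_closed[OF w'(1)] by blast
  qed
qed

lemma fp_inl_hom:
  assumes "group G" "group H"
  shows "(\<lambda>x. fp_class G H [Inl x]) \<in> hom G (free_product G H)"
proof (rule homI)
  fix x y assume xy: "x \<in> carrier G" "y \<in> carrier G"
  have "fp_eq G H ([] @ [Inl x, Inl y] @ []) ([] @ [Inl (x \<otimes>\<^bsub>G\<^esub> y)] @ [])"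
    using xy by (intro fp_eq.fp_multL) auto
  from fp_class_eq[OF this] show "fp_class G H [Inl (x \<otimes>\<^bsub>G\<^esub> y)]
      = fp_class G H [Inl x] \<otimes>\<^bsub>free_product G H\<^esub> fp_class G H [Inl y]"
    using xy by (subst mult_free_product[OF assms]) auto
qed (rule fp_class_closed, simp add: InlI)

lemma fp_inr_hom:
  assumes "group G" "group H"
  shows "(\<lambda>x. fp_class G H [Inr x]) \<in> hom H (free_product G H)"
proof (rule homI)
  fix x y assume xy: "x \<in> carrier H" "y \<in> carrier H"
  have "fp_eq G H ([] @ [Inr x, Inr y] @ []) ([] @ [Inr (x \<otimes>\<^bsub>H\<^esub> y)] @ [])"
    using xy by (intro fp_eq.fp_multR) auto
  from fp_class_eq[OF this] show "fp_class G H [Inr (x \<otimes>\<^bsub>H\<^esub> y)]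
      = fp_class G H [Inr x] \<otimes>\<^bsub>free_product G H\<^esub> fp_class G H [Inr y]"
    using xy by (subst mult_free_product[OF assms]) auto
qed (rule fp_class_closed, simp add: InrI)

lemma fp_eq_map:
  assumes "group G" "group H" "f \<in> hom G G" "g \<in> hom H H" "fp_eq G H w w'"
  shows "fp_eq G H (map (map_sum f g) w) (map (map_sum f g) w')"
proof -
  have L: "map (map_sum f g) w \<in> fp_words G H" if "w \<in> fp_words G H" for w
    using that assms(3,4) by (induction w) (auto simp: hom_in_carrier)
  show ?thesis using assms(5)
  proof (induction rule: fp_eq.induct)
    case (fp_multL us vs x y)
    then show ?case
      using fp_eq.fp_multL[OF L L, of us vs "f x" "f y"] assms(3)
      by (simp add: hom_mult hom_in_carrier)
  next
    case (fp_multR us vs x y)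
    then show ?case
      using fp_eq.fp_multR[OF L L, of us vs "g x" "g y"] assms(4)
      by (simp add: hom_mult hom_in_carrier)
  next
    case (fp_oneL us vs)
    then show ?case
      using fp_eq.fp_oneL[OF L L, of us vs] hom_one[OF assms(3,1,1)] by simp
  next
    case (fp_oneR us vs)
    then show ?case
      using fp_eq.fp_oneR[OF L L, of us vs] hom_one[OF assms(4,2,2)] by simp
  next
    case (fp_refl w)
    then show ?case by (intro fp_eq.fp_refl L)
  qed (blast intro: fp_eq.fp_sym fp_eq.fp_trans)+
qed

lemma normal_closure_normal:
  assumes "group G" "R \<subseteq> carrier G"
  shows "normal_closure G R \<lhd> G" "R \<subseteq> normal_closure G R"
proof -
  interpret group G by (rule assms(1))
  have "carrier G \<in> {N. N \<lhd> G \<and> R \<subseteq> N}"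
    using assms(2) by (auto simp: normal_inv_iff subgroup_self)
  then have eq: "normal_closure G R = \<Inter>{N. N \<lhd> G \<and> R \<subseteq> N}"
    unfolding normal_closure_def by blast
  have "subgroup (\<Inter>{N. N \<lhd> G \<and> R \<subseteq> N}) G"
    using \<open>carrier G \<in> _\<close> by (intro subgroups_Inter) (auto simp: normal_imp_subgroup)
  then show "normal_closure G R \<lhd> G"
    unfolding eq by (auto simp: normal_inv_iff)
  show "R \<subseteq> normal_closure G R" using assms(2) by (auto simp: normal_closure_def)
qed

lemma normal_closure_least: "N \<lhd> G \<Longrightarrow> R \<subseteq> N \<Longrightarrow> normal_closure G R \<subseteq> N"
  by (auto simp: normal_closure_def)

lemma group_semidirect:
  assumes N: "group N" and H: "group H"
    and \<alpha>: "\<And>h. h \<in> carrier H \<Longrightarrow> \<alpha> h \<in> hom N N"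
    and one: "\<And>n. n \<in> carrier N \<Longrightarrow> \<alpha> \<one>\<^bsub>H\<^esub> n = n"
    and mul: "\<And>h h' n. \<lbrakk>h \<in> carrier H; h' \<in> carrier H; n \<in> carrier N\<rbrakk>
      \<Longrightarrow> \<alpha> (h \<otimes>\<^bsub>H\<^esub> h') n = \<alpha> h (\<alpha> h' n)"
  shows "group (semidirect N H \<alpha>)"
proof -
  interpret N: group N by (rule N)
  interpret H: group H by (rule H)
  have c: "\<alpha> h n \<in> carrier N" if "h \<in> carrier H" "n \<in> carrier N" for h n
    using \<alpha>[OF that(1)] that(2) by (rule hom_in_carrier)
  show ?thesis
  proof (rule groupI)
    show "\<exists>y\<in>carrier (semidirect N H \<alpha>). y \<otimes>\<^bsub>semidirect N H \<alpha>\<^esub> x = \<one>\<^bsub>semidirect N H \<alpha>\<^esub>"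
      if "x \<in> carrier (semidirect N H \<alpha>)" for x
    proof -
      obtain n h where x: "x = (n, h)" "n \<in> carrier N" "h \<in> carrier H"
        using \<open>x \<in> carrier _\<close> by (auto simp: semidirect_def)
      show ?thesis
        by (rule bexI[of _ "(inv\<^bsub>N\<^esub> (\<alpha> (inv\<^bsub>H\<^esub> h) n), inv\<^bsub>H\<^esub> h)"])
          (use x in \<open>auto simp: semidirect_def c\<close>)
    qed
  qed (auto simp: semidirect_def c one mul N.m_assoc H.m_assoc hom_mult[OF \<alpha>])
qed


section \<open>The groups \<open>y(m)\<close> and \<open>y(m)\<langle>\<tau>\<rangle>\<close>\<close>

text \<open>Permutations are multiplied from left to right; \<open>sym_group\<close> composes from right to left.\<close>

definition Sym :: "nat \<Rightarrow> (nat \<Rightarrow> nat) monoid"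
  where "Sym m = (sym_group m)\<lparr>mult := (\<lambda>p q. q \<circ> p)\<rparr>"

abbreviation ZS :: "nat \<Rightarrow> (int + (nat \<Rightarrow> nat)) list set monoid"
  where "ZS m \<equiv> free_product integer_group (Sym m)"

definition free_a :: "nat \<Rightarrow> (int + (nat \<Rightarrow> nat)) list set"
  where "free_a m = fp_class integer_group (Sym m) [Inl 1]"

definition free_perm :: "nat \<Rightarrow> (nat \<Rightarrow> nat) \<Rightarrow> (int + (nat \<Rightarrow> nat)) list set"
  where "free_perm m p = fp_class integer_group (Sym m) [Inr p]"

definition free_s :: "nat \<Rightarrow> nat \<Rightarrow> (int + (nat \<Rightarrow> nat)) list set"
  where "free_s m i = free_perm m (Transposition.transpose i (i + 1))"

text \<open>A relation \<open>x = y\<close> is encoded by the relator \<open>x\<close> \<open>inv(y)\<close>.\<close>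

definition y_relators :: "nat \<Rightarrow> (int + (nat \<Rightarrow> nat)) list set set"
  where "y_relators m =
    {commutator (ZS m) (free_s m 1) (conj_by (ZS m) (free_s m 1) (free_a m [^]\<^bsub>ZS m\<^esub> k)) | k :: int. True}
    \<union> {conj_by (ZS m) (free_a m) (free_s m i) \<otimes>\<^bsub>ZS m\<^esub> inv\<^bsub>ZS m\<^esub> (inv\<^bsub>ZS m\<^esub> (free_a m))
        | i. 2 \<le> i \<and> i \<le> m - 1}"

definition y_kernel :: "nat \<Rightarrow> (int + (nat \<Rightarrow> nat)) list set set"
  where "y_kernel m = normal_closure (ZS m) (y_relators m)"

definition y_group :: "nat \<Rightarrow> (int + (nat \<Rightarrow> nat)) list set set monoid"
  where "y_group m = ZS m Mod y_kernel m"

definition y_a :: "nat \<Rightarrow> (int + (nat \<Rightarrow> nat)) list set set"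
  where "y_a m = y_kernel m #>\<^bsub>ZS m\<^esub> free_a m"

definition y_perm :: "nat \<Rightarrow> (nat \<Rightarrow> nat) \<Rightarrow> (int + (nat \<Rightarrow> nat)) list set set"
  where "y_perm m p = y_kernel m #>\<^bsub>ZS m\<^esub> free_perm m p"

definition y_s :: "nat \<Rightarrow> nat \<Rightarrow> (int + (nat \<Rightarrow> nat)) list set set"
  where "y_s m i = y_perm m (Transposition.transpose i (i + 1))"

text \<open>
  Elements of \<open>y_group m\<close> are sets of classes of words. \<open>y_flip\<close> negates every integer letter in
  every word; that this is the automorphism of \<open>y_group m\<close> which inverts \<open>a\<close> and fixes every
  permutation is shown in \<open>y_flip_iso\<close>, \<open>y_flip_a\<close> and \<open>y_flip_perm\<close> below.
\<close>

definition fp_flip :: "(int + (nat \<Rightarrow> nat)) list set \<Rightarrow> (int + (nat \<Rightarrow> nat)) list set"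
  where "fp_flip A = map (map_sum uminus id) ` A"

definition y_flip :: "(int + (nat \<Rightarrow> nat)) list set set \<Rightarrow> (int + (nat \<Rightarrow> nat)) list set set"
  where "y_flip C = fp_flip ` C"

definition yt_group :: "nat \<Rightarrow> ((int + (nat \<Rightarrow> nat)) list set set \<times> int) monoid"
  where "yt_group m =
    semidirect (y_group m) (integer_mod_group 2) (\<lambda>k. if k = 0 then id else y_flip)"

definition yt_incl ::
    "nat \<Rightarrow> (int + (nat \<Rightarrow> nat)) list set set \<Rightarrow> (int + (nat \<Rightarrow> nat)) list set set \<times> int"
  where "yt_incl m y = (y, \<one>\<^bsub>integer_mod_group 2\<^esub>)"

definition yt_tau :: "nat \<Rightarrow> (int + (nat \<Rightarrow> nat)) list set set \<times> int"
  where "yt_tau m = (\<one>\<^bsub>y_group m\<^esub>, 1)"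

definition yt_a :: "nat \<Rightarrow> (int + (nat \<Rightarrow> nat)) list set set \<times> int"
  where "yt_a m = yt_incl m (y_a m)"

definition yt_s :: "nat \<Rightarrow> nat \<Rightarrow> (int + (nat \<Rightarrow> nat)) list set set \<times> int"
  where "yt_s m i = yt_tau m \<otimes>\<^bsub>yt_group m\<^esub> yt_incl m (y_s m i)"

lemma group_Sym: "group (Sym m)"
proof (rule groupI)
  show "\<exists>y\<in>carrier (Sym m). y \<otimes>\<^bsub>Sym m\<^esub> x = \<one>\<^bsub>Sym m\<^esub>" if "x \<in> carrier (Sym m)" for x
    using that
    by (auto simp: Sym_def sym_group_def intro!: bexI[of _ "Hilbert_Choice.inv x"]
        permutes_inv permutes_inv_o)
qed (auto simp: Sym_def sym_group_def permutes_compose permutes_id comp_assoc)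

lemma group_ZS: "group (ZS m)"
  by (intro group_free_product group_Sym group_integer_group)

lemma free_a_closed: "free_a m \<in> carrier (ZS m)"
  using hom_in_carrier[OF fp_inl_hom[OF group_integer_group group_Sym]] by (simp add: free_a_def)

lemma free_perm_closed: "p permutes {1..m} \<Longrightarrow> free_perm m p \<in> carrier (ZS m)"
  using hom_in_carrier[OF fp_inr_hom[OF group_integer_group group_Sym], of p m]
  by (simp add: free_perm_def Sym_def sym_group_def)

lemma free_s_closed: "1 \<le> i \<Longrightarrow> i < m \<Longrightarrow> free_s m i \<in> carrier (ZS m)"
  unfolding free_s_def by (intro free_perm_closed permutes_swap_id) auto

lemma y_relators_closed:
  assumes "2 \<le> m"
  shows "y_relators m \<subseteq> carrier (ZS m)"
proof -
  interpret F: group "ZS m" by (rule group_ZS)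
  show ?thesis
    using assms free_a_closed[of m] free_s_closed[of _ m]
    by (auto simp: y_relators_def commutator_def conj_by_def F.int_pow_closed
        intro!: F.m_closed F.inv_closed)
qed

lemma y_kernel_normal: "2 \<le> m \<Longrightarrow> y_kernel m \<lhd> ZS m"
  unfolding y_kernel_def by (intro normal_closure_normal group_ZS y_relators_closed)

lemma group_y_group: "2 \<le> m \<Longrightarrow> group (y_group m)"
  unfolding y_group_def by (intro normal.factorgroup_is_group y_kernel_normal)

lemma fp_flip_flip: "fp_flip (fp_flip A) = A"
proof -
  have [simp]: "map_sum uminus id (map_sum uminus id x) = x" for x :: "int + (nat \<Rightarrow> nat)"
    by (cases x) auto
  show ?thesis unfolding fp_flip_def by (simp add: image_image comp_def)
qed

lemma fp_flip_class:
  "fp_flip (fp_class integer_group (Sym m) w)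
    = fp_class integer_group (Sym m) (map (map_sum uminus id) w)" 
proof -
  let ?T = fp_flip and ?c = "fp_class integer_group (Sym m)"
  have 1: "?T (?c w) \<subseteq> ?c (map (map_sum uminus id) w)" for w
  proof -
    have "(uminus :: int \<Rightarrow> int) \<in> hom integer_group integer_group" by (auto simp: hom_def)
    moreover have "id \<in> hom (Sym m) (Sym m)" by (auto simp: hom_def)
    ultimately show ?thesis
      using fp_eq_map[OF group_integer_group group_Sym]
      unfolding fp_flip_def fp_class_def by blast
  qed
  have "map_sum uminus id (map_sum uminus id x) = x" for x :: "int + (nat \<Rightarrow> nat)"
    by (cases x) auto
  then have "?T (?c (map (map_sum uminus id) w)) \<subseteq> ?c w"
    using 1[of "map (map_sum uminus id) w"] by (simp add: comp_def)
  then have "?T (?T (?c (map (map_sum uminus id) w))) \<subseteq> ?T (?c w)"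
    unfolding fp_flip_def by (rule image_mono)
  with 1[of w] show ?thesis by (simp add: fp_flip_flip)
qed

lemma fp_flip_hom: "fp_flip \<in> hom (ZS m) (ZS m)"
proof -
  have L: "map (map_sum uminus id) w \<in> fp_words integer_group (Sym m)"
    if "w \<in> fp_words integer_group (Sym m)" for w
    using that by (induction w) auto
  have cE: "\<exists>w\<in>fp_words integer_group (Sym m). A = fp_class integer_group (Sym m) w"
    if "A \<in> carrier (ZS m)" for A
    using that unfolding carrier_free_product by blast
  note mult = mult_free_product[OF group_integer_group group_Sym]
  show ?thesis
  proof (rule homI)
    fix A B assume "A \<in> carrier (ZS m)" "B \<in> carrier (ZS m)"
    then obtain w w' where w: "w \<in> fp_words integer_group (Sym m)" "w' \<in> fp_words integer_group (Sym m)"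
      and AB: "A = fp_class integer_group (Sym m) w" "B = fp_class integer_group (Sym m) w'"
      using cE by meson
    show "fp_flip A \<in> carrier (ZS m)"
      unfolding AB fp_flip_class by (intro fp_class_closed L w)
    show "fp_flip (A \<otimes>\<^bsub>ZS m\<^esub> B) = fp_flip A \<otimes>\<^bsub>ZS m\<^esub> fp_flip B"
      unfolding AB by (simp only: mult w L fp_flip_class map_append)
  qed
qed

lemma fp_flip_a: "fp_flip (free_a m) = inv\<^bsub>ZS m\<^esub> (free_a m)"
proof -
  interpret group_hom integer_group "ZS m" "\<lambda>x. fp_class integer_group (Sym m) [Inl x]"
    by (intro group_hom.intro group_hom_axioms.intro fp_inl_hom group_ZS group_Sym group_integer_group)
  show ?thesis using hom_inv[of 1] by (simp add: free_a_def fp_flip_class)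
qed

lemma fp_flip_perm: "fp_flip (free_perm m p) = free_perm m p"
  by (simp add: free_perm_def fp_flip_class)

lemma fp_flip_kernel:
  assumes m: "2 \<le> m"
  shows "fp_flip ` y_kernel m = y_kernel m"
proof -
  interpret F: group "ZS m" by (rule group_ZS)
  interpret T: group_hom "ZS m" "ZS m" fp_flip
    by (intro group_hom.intro group_hom_axioms.intro group_ZS fp_flip_hom)
  interpret K: normal "y_kernel m" "ZS m" by (rule y_kernel_normal[OF m])
  have R: "y_relators m \<subseteq> y_kernel m"
    unfolding y_kernel_def by (intro normal_closure_normal group_ZS y_relators_closed m)
  note a = free_a_closed[of m]
  have fs: "fp_flip (free_s m i) = free_s m i" for i by (simp add: free_s_def fp_flip_perm)
  have gen: "fp_flip ` y_relators m \<subseteq> y_kernel m"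
  proof (rule image_subsetI)
    fix r assume "r \<in> y_relators m"
    then consider (comm) k :: int where
        "r = commutator (ZS m) (free_s m 1) (conj_by (ZS m) (free_s m 1) (free_a m [^]\<^bsub>ZS m\<^esub> k))"
      | (conj) i where "2 \<le> i" "i \<le> m - 1"
        "r = conj_by (ZS m) (free_a m) (free_s m i) \<otimes>\<^bsub>ZS m\<^esub> inv\<^bsub>ZS m\<^esub> (inv\<^bsub>ZS m\<^esub> (free_a m))"
      unfolding y_relators_def by blast
    then show "fp_flip r \<in> y_kernel m"
    proof cases
      case comm
      have s: "free_s m 1 \<in> carrier (ZS m)" using m by (intro free_s_closed) auto
      have "fp_flip (free_a m [^]\<^bsub>ZS m\<^esub> k) = free_a m [^]\<^bsub>ZS m\<^esub> (- k)"
        using a by (simp add: T.hom_int_pow fp_flip_a F.int_pow_inv F.int_pow_neg)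
      then have "fp_flip r = commutator (ZS m) (free_s m 1)
          (conj_by (ZS m) (free_s m 1) (free_a m [^]\<^bsub>ZS m\<^esub> (- k)))"
        using s a unfolding comm commutator_def conj_by_def
        by (simp add: fs F.int_pow_closed)
      then have "fp_flip r \<in> y_relators m" unfolding y_relators_def by blast
      then show ?thesis using R by blast
    next
      case conj
      have s: "free_s m i \<in> carrier (ZS m)" using conj by (intro free_s_closed) auto
      define A S where "A = free_a m" and "S = free_s m i"
      note AS = a[folded A_def] s[folded S_def]
      have r: "r = inv\<^bsub>ZS m\<^esub> S \<otimes>\<^bsub>ZS m\<^esub> A \<otimes>\<^bsub>ZS m\<^esub> S \<otimes>\<^bsub>ZS m\<^esub> A"
        using AS unfolding conj(3) conj_by_def A_def[symmetric] S_def[symmetric] by simp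
      have rK: "r \<in> y_kernel m" and rc: "r \<in> carrier (ZS m)"
        using R \<open>r \<in> y_relators m\<close> y_relators_closed[OF m] by auto
      have cancel: "A \<otimes>\<^bsub>ZS m\<^esub> (inv\<^bsub>ZS m\<^esub> A \<otimes>\<^bsub>ZS m\<^esub> Z) = Z" if "Z \<in> carrier (ZS m)" for Z
        using AS that by (simp flip: F.m_assoc)
      have "fp_flip r = inv\<^bsub>ZS m\<^esub> S \<otimes>\<^bsub>ZS m\<^esub> inv\<^bsub>ZS m\<^esub> A \<otimes>\<^bsub>ZS m\<^esub> S \<otimes>\<^bsub>ZS m\<^esub> inv\<^bsub>ZS m\<^esub> A"
        using AS unfolding r by (simp add: fs fp_flip_a A_def S_def)
      also have "\<dots> = A \<otimes>\<^bsub>ZS m\<^esub> inv\<^bsub>ZS m\<^esub> r \<otimes>\<^bsub>ZS m\<^esub> inv\<^bsub>ZS m\<^esub> A"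
        using AS cancel unfolding r by (simp add: F.inv_mult_group F.m_assoc)
      also have "\<dots> \<in> y_kernel m"
        using AS(1) rK by (intro K.inv_op_closed2 K.m_inv_closed)
      finally show ?thesis .
    qed
  qed
  let ?P = "{x \<in> carrier (ZS m). fp_flip x \<in> y_kernel m}"
  have "?P \<lhd> ZS m"
  proof (rule F.normal_invI)
    show "subgroup ?P (ZS m)"
      by (rule F.subgroupI) (auto intro!: exI[of _ "\<one>\<^bsub>ZS m\<^esub>"])
  qed (auto intro: K.inv_op_closed2)
  then have "y_kernel m \<subseteq> ?P"
    using gen y_relators_closed[OF m] by (subst y_kernel_def) (rule normal_closure_least, auto)
  then have sub: "fp_flip ` y_kernel m \<subseteq> y_kernel m" by auto
  then have "fp_flip ` fp_flip ` y_kernel m \<subseteq> fp_flip ` y_kernel m" by (rule image_mono)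
  then have "y_kernel m \<subseteq> fp_flip ` y_kernel m" by (simp add: image_image fp_flip_flip)
  with sub show ?thesis by blast
qed

lemma y_flip_coset:
  assumes m: "2 \<le> m" and x: "x \<in> carrier (ZS m)"
  shows "y_flip (y_kernel m #>\<^bsub>ZS m\<^esub> x) = y_kernel m #>\<^bsub>ZS m\<^esub> fp_flip x"
proof -
  interpret K: normal "y_kernel m" "ZS m" by (rule y_kernel_normal[OF m])
  have "y_flip (y_kernel m #>\<^bsub>ZS m\<^esub> x) = (\<lambda>h. fp_flip h \<otimes>\<^bsub>ZS m\<^esub> fp_flip x) ` y_kernel m"
    using x by (auto simp: y_flip_def r_coset_def hom_mult[OF fp_flip_hom] image_iff)
  also have "\<dots> = (\<lambda>h. h \<otimes>\<^bsub>ZS m\<^esub> fp_flip x) ` fp_flip ` y_kernel m"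
    by (simp add: image_image)
  also have "\<dots> = y_kernel m #>\<^bsub>ZS m\<^esub> fp_flip x"
    unfolding fp_flip_kernel[OF m] by (auto simp: r_coset_def)
  finally show ?thesis .
qed

lemma y_flip_flip: "y_flip (y_flip C) = C"
  by (simp add: y_flip_def image_image fp_flip_flip)

lemma y_flip_iso:
  assumes m: "2 \<le> m"
  shows "y_flip \<in> iso (y_group m) (y_group m)"
proof -
  interpret K: normal "y_kernel m" "ZS m" by (rule y_kernel_normal[OF m])
  have closed: "y_flip C \<in> carrier (y_group m)" if "C \<in> carrier (y_group m)" for C
    using that m by (auto simp: y_group_def carrier_FactGroup y_flip_coset hom_in_carrier[OF fp_flip_hom])
  have "y_flip \<in> hom (y_group m) (y_group m)"
  proof (rule homI)
    fix C D assume "C \<in> carrier (y_group m)" "D \<in> carrier (y_group m)"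
    then show "y_flip (C \<otimes>\<^bsub>y_group m\<^esub> D) = y_flip C \<otimes>\<^bsub>y_group m\<^esub> y_flip D"
      using m by (auto simp: y_group_def carrier_FactGroup K.rcos_sum y_flip_coset
          hom_in_carrier[OF fp_flip_hom] hom_mult[OF fp_flip_hom])
  qed (rule closed)
  moreover have "bij_betw y_flip (carrier (y_group m)) (carrier (y_group m))"
    by (rule bij_betw_byWitness[where f' = y_flip]) (auto simp: y_flip_flip closed)
  ultimately show ?thesis by (simp add: iso_def)
qed

lemma y_flip_a:
  assumes m: "2 \<le> m"
  shows "y_flip (y_a m) = inv\<^bsub>y_group m\<^esub> (y_a m)"
proof -
  interpret K: normal "y_kernel m" "ZS m" by (rule y_kernel_normal[OF m])
  have "y_a m \<in> carrier (ZS m Mod y_kernel m)"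
    using free_a_closed by (auto simp: carrier_FactGroup y_a_def)
  then show ?thesis
    using m free_a_closed[of m]
    by (simp add: y_group_def K.inv_FactGroup y_a_def y_flip_coset fp_flip_a K.rcos_inv)
qed

lemma y_flip_perm: "2 \<le> m \<Longrightarrow> p permutes {1..m} \<Longrightarrow> y_flip (y_perm m p) = y_perm m p"
  by (simp add: y_perm_def y_flip_coset free_perm_closed fp_flip_perm)

lemma group_yt_group:
  assumes m: "2 \<le> m"
  shows "group (yt_group m)"
  unfolding yt_group_def
proof (rule group_semidirect)
  show "(if h = 0 then id else y_flip) \<in> hom (y_group m) (y_group m)" for h :: int
    using y_flip_iso[OF m] by (auto simp: iso_def hom_def)
  fix h h' :: int and n
  assume "h \<in> carrier (integer_mod_group 2)" "h' \<in> carrier (integer_mod_group 2)"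
  then have "h = 0 \<or> h = 1" "h' = 0 \<or> h' = 1" by (auto simp: carrier_integer_mod_group)
  then show "(if h \<otimes>\<^bsub>integer_mod_group 2\<^esub> h' = 0 then id else y_flip) n =
      (if h = 0 then id else y_flip) ((if h' = 0 then id else y_flip) n)"
    by (auto simp: y_flip_flip integer_mod_group_def)
qed (auto simp: group_y_group m)


section \<open>The quadratic module \<open>(V, q)\<close> and its orthogonal group\<close>

text \<open>
  Finitely supported functions from \<open>int\<close> to a ring, with convolution as product, are the Laurent
  polynomials over that ring; \<open>bit\<close> is the field with two elements.
\<close>

type_synonym laurent = "int \<Rightarrow>\<^sub>0 bit"

definition t_inv :: laurent
  where "t_inv = Poly_Mapping.single (- 1) 1"

text \<open>
  A vector is its coordinate function: coordinate \<open>0\<close> belongs to \<open>u\<close> and coordinate \<open>i\<close>,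
  for \<open>1 \<le> i \<le> m\<close>, to \<open>v\<^sub>i\<close>.
\<close>

type_synonym vec = "nat \<Rightarrow> laurent"

definition V :: "nat \<Rightarrow> vec set"
  where "V m = {x. \<forall>i>m. x i = 0}"

definition scal :: "laurent \<Rightarrow> vec \<Rightarrow> vec"
  where "scal c x = (\<lambda>i. c * x i)"

definition u :: vec
  where "u = (\<lambda>j. if j = 0 then 1 else 0)"

definition v :: "nat \<Rightarrow> vec"
  where "v i = (\<lambda>j. if j = i then 1 else 0)"

text \<open>The Gram matrix of \<open>bil\<close> in the basis \<open>u, v\<^sub>1, \<dots>, v\<^sub>m\<close> has entry \<open>0\<close> on the diagonal and \<open>1\<close> off it.\<close>

definition bil :: "nat \<Rightarrow> vec \<Rightarrow> vec \<Rightarrow> laurent"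
  where "bil m x y = (\<Sum>i\<le>m. \<Sum>j\<in>{..m} - {i}. x i * y j)"

text \<open>
  The quadratic form with polar form \<open>bil\<close> and the values \<open>1\<close> at \<open>u\<close> and \<open>t\<close> to the power \<open>-1\<close> at
  each \<open>v\<^sub>i\<close>; see \<open>q_scal\<close>, \<open>q_add\<close> and \<open>q_basis\<close> below.
\<close>

definition q :: "nat \<Rightarrow> vec \<Rightarrow> laurent"
  where "q m x = x 0 ^ 2 + (\<Sum>i=1..m. t_inv * x i ^ 2) + (\<Sum>i\<le>m. \<Sum>j<i. x i * x j)"

text \<open>Meaningful for units only, as is \<open>transvection m w\<close> only when \<open>q m w\<close> is a unit.\<close>

definition unit_inv :: "laurent \<Rightarrow> laurent"
  where "unit_inv c = (THE d. c * d = 1)"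

definition transvection :: "nat \<Rightarrow> vec \<Rightarrow> vec \<Rightarrow> vec"
  where "transvection m w = (\<lambda>x \<in> V m. x + scal (bil m x w * unit_inv (q m w)) w)"

text \<open>Maps act on the right, so the product of \<open>f\<close> and \<open>g\<close> applies \<open>f\<close> first.\<close>

definition orthogonal_group :: "nat \<Rightarrow> (vec \<Rightarrow> vec) monoid"
  where "orthogonal_group m =
    \<lparr>carrier = {f \<in> Bij (V m).
        (\<forall>x\<in>V m. \<forall>y\<in>V m. f (x + y) = f x + f y) \<and>
        (\<forall>c. \<forall>x\<in>V m. f (scal c x) = scal c (f x)) \<and>
        (\<forall>x\<in>V m. q m (f x) = q m x)},
     mult = (\<lambda>f g. compose (V m) g f),
     one = (\<lambda>x \<in> V m. x)\<rparr>"

lemma t_inv_unit: "t_inv * Poly_Mapping.single 1 1 = 1"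
  by (simp add: t_inv_def mult_single flip: single_one)

lemma unit_inv_eq: "c * d = 1 \<Longrightarrow> unit_inv c = d"
  unfolding unit_inv_def
proof (rule the_equality)
  fix x assume cd: "c * d = 1" and cx: "c * x = 1"
  have "x = (c * d) * x" by (simp only: cd mult_1_left)
  also have "\<dots> = (c * x) * d" by (simp only: ac_simps)
  also have "\<dots> = d" by (simp only: cx mult_1_left)
  finally show "x = d" .
qed

lemma laurent_add_self: "x + x = (0 :: laurent)"
proof (rule poly_mapping_eqI)
  have "b + b = 0" for b :: bit by (cases b) simp_all
  then show "Poly_Mapping.lookup (x + x) k = Poly_Mapping.lookup 0 k" for k
    by (simp only: lookup_add lookup_zero)
qed

lemma V_closed:
  "u \<in> V m" "i \<le> m \<Longrightarrow> v i \<in> V m" "x \<in> V m \<Longrightarrow> y \<in> V m \<Longrightarrow> x + y \<in> V m"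
  "x \<in> V m \<Longrightarrow> scal c x \<in> V m"
  by (auto simp: V_def u_def v_def scal_def)

lemma bil_add: "bil m (x + y) z = bil m x z + bil m y z" "bil m z (x + y) = bil m z x + bil m z y"
  by (simp_all add: bil_def sum.distrib algebra_simps)

lemma bil_scal: "bil m (scal c x) y = c * bil m x y" "bil m x (scal c y) = c * bil m x y"
  by (simp_all add: bil_def scal_def sum_distrib_left algebra_simps)

lemma bil_split:
  "bil m x y = (\<Sum>i\<le>m. \<Sum>j<i. x i * y j) + (\<Sum>i\<le>m. \<Sum>j<i. y i * x j)"
proof -
  have "bil m x y = (\<Sum>i\<le>m. (\<Sum>j<i. x i * y j) + (\<Sum>j\<in>{i<..m}. x i * y j))"
    unfolding bil_def
  proof (rule sum.cong)
    fix i assume "i \<in> {..m}"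
    then have eq: "{..m} - {i} = {..<i} \<union> {i<..m}" by auto
    show "(\<Sum>j\<in>{..m} - {i}. x i * y j) = (\<Sum>j<i. x i * y j) + (\<Sum>j\<in>{i<..m}. x i * y j)"
      by (subst eq, intro sum.union_disjoint) auto
  qed simp
  also have "\<dots> = (\<Sum>i\<le>m. \<Sum>j<i. x i * y j) + (\<Sum>i\<le>m. \<Sum>j\<in>{i<..m}. x i * y j)"
    by (simp add: sum.distrib)
  also have "(\<Sum>i\<le>m. \<Sum>j\<in>{i<..m}. x i * y j) = (\<Sum>j\<le>m. \<Sum>i<j. x i * y j)"
    unfolding sum.Sigma[OF finite_atMost ballI[OF finite_greaterThanAtMost]]
      sum.Sigma[OF finite_atMost ballI[OF finite_lessThan]]
    by (rule sum.reindex_bij_witness[of _ "\<lambda>(a, b). (b, a)" "\<lambda>(a, b). (b, a)"]) auto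
  also have "\<dots> = (\<Sum>i\<le>m. \<Sum>j<i. y i * x j)" by (simp add: mult.commute)
  finally show ?thesis .
qed

lemma bil_alternating: "bil m x x = 0"
  by (simp add: bil_split laurent_add_self)

lemma bil_basis:
  "1 \<le> i \<Longrightarrow> i \<le> m \<Longrightarrow> bil m u (v i) = 1"
  "i \<le> m \<Longrightarrow> j \<le> m \<Longrightarrow> i \<noteq> j \<Longrightarrow> bil m (v i) (v j) = 1"
proof -
  show *: "bil m (v i) (v j) = 1" if "i \<le> m" "j \<le> m" "i \<noteq> j" for i j
  proof -
    have "bil m (v i) (v j) = (\<Sum>k\<le>m. if k = i then \<Sum>l\<in>{..m} - {k}. if l = j then 1 else 0 else 0)"
      unfolding bil_def v_def by (intro sum.cong) (auto intro!: sum.cong)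
    also have "\<dots> = 1" using that by (simp add: sum.delta')
    finally show ?thesis .
  qed
  show "bil m u (v i) = 1" if "1 \<le> i" "i \<le> m"
    using *[of 0 i] that by (simp add: u_def v_def)
qed

lemma q_scal: "q m (scal c x) = c ^ 2 * q m x"
  by (simp add: q_def scal_def sum_distrib_left power2_eq_square algebra_simps)

lemma q_add: "q m (x + y) = q m x + q m y + bil m x y"
proof -
  have sq: "(a + b) ^ 2 = a ^ 2 + b ^ 2" for a b :: laurent
  proof -
    have "(a + b) ^ 2 = a ^ 2 + b ^ 2 + (a * b + a * b)"
      by (simp add: power2_eq_square algebra_simps)
    then show ?thesis by (simp only: laurent_add_self add_0_right)
  qed
  show ?thesis
    unfolding q_def bil_split by (simp add: sq sum.distrib algebra_simps)
qed

lemma q_basis: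
  "q m u = 1"
  "1 \<le> i \<Longrightarrow> i \<le> m \<Longrightarrow> q m (v i) = t_inv"
proof -
  have off: "(\<Sum>k\<le>m. \<Sum>j<k. v i k * v i j) = 0" for i
    by (intro sum.neutral ballI) (auto simp: v_def)
  have "u = v 0" by (simp add: u_def v_def)
  show "q m u = 1" unfolding q_def \<open>u = v 0\<close> off by (simp add: v_def)
  show "q m (v i) = t_inv" if "1 \<le> i" "i \<le> m"
  proof -
    have "(\<Sum>k=1..m. t_inv * v i k ^ 2) = (\<Sum>k=1..m. if k = i then t_inv else 0)"
      by (intro sum.cong) (auto simp: v_def)
    then show ?thesis unfolding q_def off using that by simp (simp add: v_def)
  qed
qed

lemma group_orthogonal_group: "group (orthogonal_group m)"
proof (rule groupI)
  show "f \<otimes>\<^bsub>orthogonal_group m\<^esub> g \<in> carrier (orthogonal_group m)"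
    if "f \<in> carrier (orthogonal_group m)" "g \<in> carrier (orthogonal_group m)" for f g
  proof -
    have "f x \<in> V m" if "x \<in> V m" for x
      using that \<open>f \<in> carrier _\<close> by (auto simp: orthogonal_group_def Bij_def bij_betw_def)
    then show ?thesis
      using that by (auto simp: orthogonal_group_def compose_Bij compose_eq V_closed)
  qed
  show "\<one>\<^bsub>orthogonal_group m\<^esub> \<in> carrier (orthogonal_group m)"
    by (auto simp: orthogonal_group_def id_Bij V_closed)
  show "f \<otimes>\<^bsub>orthogonal_group m\<^esub> g \<otimes>\<^bsub>orthogonal_group m\<^esub> h
      = f \<otimes>\<^bsub>orthogonal_group m\<^esub> (g \<otimes>\<^bsub>orthogonal_group m\<^esub> h)"
    if "f \<in> carrier (orthogonal_group m)" for f g h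
    using that by (auto simp: orthogonal_group_def Bij_imp_funcset compose_assoc)
  show "\<one>\<^bsub>orthogonal_group m\<^esub> \<otimes>\<^bsub>orthogonal_group m\<^esub> f = f"
    if "f \<in> carrier (orthogonal_group m)" for f
    using that compose_Id[OF Bij_imp_funcset Bij_imp_extensional, of f "V m"]
    by (simp add: orthogonal_group_def)
  show "\<exists>g\<in>carrier (orthogonal_group m). g \<otimes>\<^bsub>orthogonal_group m\<^esub> f = \<one>\<^bsub>orthogonal_group m\<^esub>"
    if f: "f \<in> carrier (orthogonal_group m)" for f
  proof -
    have fB: "f \<in> Bij (V m)" and bij: "bij_betw f (V m) (V m)"
      and add: "\<And>x y. x \<in> V m \<Longrightarrow> y \<in> V m \<Longrightarrow> f (x + y) = f x + f y"
      and sc: "\<And>c x. x \<in> V m \<Longrightarrow> f (scal c x) = scal c (f x)"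
      and qf: "\<And>x. x \<in> V m \<Longrightarrow> q m (f x) = q m x"
      using f by (auto simp: orthogonal_group_def Bij_def)
    define g where "g = (\<lambda>x \<in> V m. inv_into (V m) f x)"
    have g: "g \<in> Bij (V m)" unfolding g_def by (rule restrict_inv_into_Bij[OF fB])
    have gV: "g x \<in> V m" and fg: "f (g x) = x" if "x \<in> V m" for x
      using that bij unfolding g_def
      by (auto simp: bij_betw_def inv_into_into f_inv_into_f)
    have gf: "g (f x) = x" if "x \<in> V m" for x
      using that bij unfolding g_def by (auto simp: bij_betw_def)
    have "g (x + y) = g x + g y" if "x \<in> V m" "y \<in> V m" for x y
      using gf[of "g x + g y"] that by (simp add: add gV fg V_closed)
    moreover have "g (scal c x) = scal c (g x)" if "x \<in> V m" for x c
      using gf[of "scal c (g x)"] that by (simp add: sc gV fg V_closed)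
    moreover have "q m (g x) = q m x" if "x \<in> V m" for x
      using qf[of "g x"] that by (simp add: gV fg)
    ultimately have gc: "g \<in> carrier (orthogonal_group m)"
      using g by (auto simp: orthogonal_group_def)
    have "compose (V m) f g = (\<lambda>x \<in> V m. x)"
      by (auto simp: compose_def fg)
    then show ?thesis using gc by (auto simp: orthogonal_group_def)
  qed
qed

end

theory Submission
  imports Defs
begin

text \<open>
  A homomorphism out of \<open>y(m)\<langle>\<tau>\<rangle>\<close> is given by an element \<open>A\<close>, a homomorphism \<open>S\<close> on \<open>S\<^sub>m\<close> and an
  involution \<open>T\<close> such that \<open>A\<close> and \<open>S\<close> satisfy the relations of \<open>y(m)\<close>, \<open>T\<close> inverts \<open>A\<close>, and
  \<open>T\<close> centralises the image of \<open>S\<close> (\<open>yt_group_universal\<close>). Here \<open>T = r\<^sub>u\<close> and \<open>A = r\<^sub>u r\<^sub>v\<close> with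
  \<open>v = v\<^sub>1\<close>. A product of two involutions is inverted by each of them.

  The homomorphism \<open>S\<close> comes from permuting the \<open>v\<^sub>i\<close>. The transvection in \<open>v\<^sub>i + v\<^sub>j\<close> just exchanges
  \<open>v\<^sub>i\<close> and \<open>v\<^sub>j\<close> (\<open>transvection_eq_perm_act\<close>), so it belongs to the permutation action of
  \<open>S\<^sub>m\<close> on the basis. As the image of \<open>s\<^sub>i\<close> has to be \<open>r\<^sub>u\<close> times the transvection in
  \<open>v\<^sub>i + v\<^sub>i\<^sub>+\<^sub>1\<close>, and \<open>r\<^sub>u\<close> commutes with all permutations of the \<open>v\<^sub>i\<close>, the map \<open>S\<close> sends a
  permutation \<open>p\<close> to its permutation action, multiplied by \<open>r\<^sub>u\<close> when \<open>p\<close> is odd (\<open>signed_perm_hom\<close>).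

  For \<open>i \<ge> 2\<close> the transposition \<open>s\<^sub>i\<close> fixes \<open>v\<^sub>1\<close>, so its permutation action commutes with \<open>A\<close> and
  the factor \<open>r\<^sub>u\<close> in \<open>S s\<^sub>i\<close> inverts \<open>A\<close>.

  For the commutator relations, put \<open>e = u + v\<^sub>1 + v\<^sub>2\<close>. This vector is singular and orthogonal to \<open>u\<close>
  and \<open>v\<^sub>1\<close>, hence fixed by \<open>A\<close>, and \<open>S s\<^sub>1\<close> is the product of the transvections in \<open>u\<close> and
  \<open>u + e\<close>. Such a product is an Eichler transformation with centre \<open>e\<close>
  (\<open>transvection_mult_eq_eichler\<close>). Conjugation by a power of \<open>A\<close> yields another one with
  the same centre (\<open>eichler_orthogonal_commute\<close>), and any two with the same centre commute, because
  they multiply by adding their second parameters (\<open>eichler_mult\<close>).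
\<close>

section \<open>Homomorphisms out of free products, presented groups and semidirect products\<close>

lemma (in group) conj_by_eqI:
  assumes "x \<in> carrier G" "y \<in> carrier G" "g \<in> carrier G" "x \<otimes> g = g \<otimes> y"
  shows "conj_by G x g = y"
  using assms by (simp add: conj_by_def m_assoc inv_solve_left')

lemma (in group) commutator_eq_one:
  assumes "x \<in> carrier G" "y \<in> carrier G" "x \<otimes> y = y \<otimes> x"
  shows "commutator G x y = \<one>"
  using assms by (simp add: commutator_def m_assoc flip: inv_mult_group)

lemma (in group_hom) hom_conj_by:
  "\<lbrakk>x \<in> carrier G; y \<in> carrier G\<rbrakk> \<Longrightarrow> h (conj_by G x y) = conj_by H (h x) (h y)"
  by (simp add: conj_by_def)

lemma (in group_hom) hom_commutator:
  "\<lbrakk>x \<in> carrier G; y \<in> carrier G\<rbrakk> \<Longrightarrow> h (commutator G x y) = commutator H (h x) (h y)"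
  by (simp add: commutator_def)

text \<open>
  The homomorphism multiplies the images of the letters of a word; this value is constant on
  classes because it respects each generating step of the congruence.
\<close>

lemma free_product_universal:
  assumes "group G" "group H" "group K" and f: "f \<in> hom G K" and g: "g \<in> hom H K"
  obtains h where "h \<in> hom (free_product G H) K"
    "\<And>x. x \<in> carrier G \<Longrightarrow> h (fp_class G H [Inl x]) = f x"
    "\<And>y. y \<in> carrier H \<Longrightarrow> h (fp_class G H [Inr y]) = g y"
proof -
  interpret G: group G by (rule assms(1))
  interpret H: group H by (rule assms(2))
  interpret K: group K by (rule assms(3))
  have fc: "f x \<in> carrier K" if "x \<in> carrier G" for x using f that by (rule hom_in_carrier)
  have gc: "g y \<in> carrier K" if "y \<in> carrier H" for y using g that by (rule hom_in_carrier)
  define ev where "ev w = foldr (\<lambda>c k. case_sum f g c \<otimes>\<^bsub>K\<^esub> k) w \<one>\<^bsub>K\<^esub>" for w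
  have evc: "ev w \<in> carrier K" if "w \<in> fp_words G H" for w
    using that by (induction w) (auto simp: ev_def fc gc)
  have ev_append: "ev (w @ w') = ev w \<otimes>\<^bsub>K\<^esub> ev w'" if "w \<in> fp_words G H" "w' \<in> fp_words G H" for w w'
    using that(1)
  proof (induction w)
    case (Cons c w)
    have c: "case_sum f g c \<in> carrier K" using Cons.hyps by (auto simp: fc gc)
    have Cons_ev: "ev (c # w) = case_sum f g c \<otimes>\<^bsub>K\<^esub> ev w" for w by (simp add: ev_def)
    show ?case using Cons c by (simp add: Cons_ev K.m_assoc evc that)
  qed (simp add: ev_def evc[unfolded ev_def] that)
  have ev1: "ev [c] = case_sum f g c" if "c \<in> carrier G <+> carrier H" for c
    using that by (auto simp: ev_def fc gc)
  have ev2: "ev [c, d] = case_sum f g c \<otimes>\<^bsub>K\<^esub> case_sum f g d"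
    if "c \<in> carrier G <+> carrier H" "d \<in> carrier G <+> carrier H" for c d
    using that by (auto simp: ev_def fc gc)
  have ev_mid: "ev (us @ ws @ vs) = ev us \<otimes>\<^bsub>K\<^esub> (ev ws \<otimes>\<^bsub>K\<^esub> ev vs)"
    if "us \<in> fp_words G H" "ws \<in> fp_words G H" "vs \<in> fp_words G H" for us ws vs
    using that by (simp add: ev_append del: append_assoc)
  have ev_eq: "ev w = ev w'" if "fp_eq G H w w'" for w w'
    using that
  proof (induction rule: fp_eq.induct)
    case (fp_multL us vs x y)
    have "x \<otimes>\<^bsub>G\<^esub> y \<in> carrier G" using fp_multL.hyps by simp
    with fp_multL.hyps have "ev [Inl x, Inl y] = ev [Inl (x \<otimes>\<^bsub>G\<^esub> y)]"
      and "[Inl x, Inl y] \<in> fp_words G H" "[Inl (x \<otimes>\<^bsub>G\<^esub> y)] \<in> fp_words G H"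
      by (simp_all add: ev1 ev2 hom_mult[OF f] InlI)
    then show ?case using fp_multL.hyps by (simp only: ev_mid)
  next
    case (fp_multR us vs x y)
    have "x \<otimes>\<^bsub>H\<^esub> y \<in> carrier H" using fp_multR.hyps by simp
    with fp_multR.hyps have "ev [Inr x, Inr y] = ev [Inr (x \<otimes>\<^bsub>H\<^esub> y)]"
      and "[Inr x, Inr y] \<in> fp_words G H" "[Inr (x \<otimes>\<^bsub>H\<^esub> y)] \<in> fp_words G H"
      by (simp_all add: ev1 ev2 hom_mult[OF g] InrI)
    then show ?case using fp_multR.hyps by (simp only: ev_mid)
  next
    case (fp_oneL us vs)
    have "ev [Inl \<one>\<^bsub>G\<^esub>] = \<one>\<^bsub>K\<^esub>" and "[Inl \<one>\<^bsub>G\<^esub>] \<in> fp_words G H"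
      by (simp_all add: ev1 hom_one[OF f assms(1,3)] InlI)
    then show ?case using fp_oneL.hyps by (simp only: ev_mid ev_append) (simp add: evc)
  next
    case (fp_oneR us vs)
    have "ev [Inr \<one>\<^bsub>H\<^esub>] = \<one>\<^bsub>K\<^esub>" and "[Inr \<one>\<^bsub>H\<^esub>] \<in> fp_words G H"
      by (simp_all add: ev1 hom_one[OF g assms(2,3)] InrI)
    then show ?case using fp_oneR.hyps by (simp only: ev_mid ev_append) (simp add: evc)
  qed simp_all
  have "ev w = ev w'"
    if "w \<in> fp_words G H" "w' \<in> fp_words G H" "fp_class G H w = fp_class G H w'" for w w'
    using fp_class_self[OF that(2), folded that(3)] by (intro ev_eq) (simp add: fp_class_def)
  then obtain h where h: "\<And>w. w \<in> fp_words G H \<Longrightarrow> ev w = h (fp_class G H w)"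
    using function_factors_left_gen[of "\<lambda>w. w \<in> fp_words G H" "fp_class G H" ev] by blast
  show thesis
  proof
    show "h \<in> hom (free_product G H) K"
    proof (rule homI)
      fix A B assume "A \<in> carrier (free_product G H)" "B \<in> carrier (free_product G H)"
      then obtain w w' where w: "w \<in> fp_words G H" "w' \<in> fp_words G H"
        and AB: "A = fp_class G H w" "B = fp_class G H w'"
        unfolding carrier_free_product by blast
      show "h A \<in> carrier K" using evc[OF w(1)] by (simp add: AB h w)
      show "h (A \<otimes>\<^bsub>free_product G H\<^esub> B) = h A \<otimes>\<^bsub>K\<^esub> h B"
        using w unfolding AB mult_free_product[OF assms(1,2) w]
        by (simp add: ev_append flip: h)
    qed
    show "h (fp_class G H [Inl x]) = f x" if "x \<in> carrier G" for x
      using that by (simp add: InlI ev1 flip: h)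
    show "h (fp_class G H [Inr y]) = g y" if "y \<in> carrier H" for y
      using that by (simp add: InrI ev1 flip: h)
  qed
qed

lemma free_product_hom_eqI:
  assumes "group G" "group H" "group K"
    and h: "h \<in> hom (free_product G H) K" and k: "k \<in> hom (free_product G H) K"
    and L: "\<And>x. x \<in> carrier G \<Longrightarrow> h (fp_class G H [Inl x]) = k (fp_class G H [Inl x])"
    and R: "\<And>y. y \<in> carrier H \<Longrightarrow> h (fp_class G H [Inr y]) = k (fp_class G H [Inr y])"
    and A: "A \<in> carrier (free_product G H)"
  shows "h A = k A"
proof -
  have "h (fp_class G H w) = k (fp_class G H w)" if "w \<in> fp_words G H" for w
    using that
  proof (induction w)
    case Nil
    show ?case
      using hom_one[OF h group_free_product assms(3)] hom_one[OF k group_free_product assms(3)]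
        assms(1,2) by (simp add: one_free_product)
  next
    case (Cons c w)
    have c: "[c] \<in> fp_words G H" using Cons.hyps by simp
    have "h (fp_class G H [c]) = k (fp_class G H [c])"
      using Cons.hyps(1) L R by auto
    moreover have "fp_class G H (c # w) = fp_class G H [c] \<otimes>\<^bsub>free_product G H\<^esub> fp_class G H w"
      using mult_free_product[OF assms(1,2) c] Cons.hyps(2) by simp
    ultimately show ?case
      using Cons.IH hom_mult[OF h] hom_mult[OF k] fp_class_closed[OF c]
        fp_class_closed[OF Cons.hyps(2)[folded in_lists_conv_set]]
      by simp
  qed
  then show ?thesis using A by (auto simp: carrier_free_product)
qed

text \<open>
  In the semidirect product \<open>\<alpha> h n\<close> is \<open>h n inv(h)\<close>, so the last hypothesis is the
  image of the relation \<open>(\<alpha> h n) h = h n\<close>.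
\<close>

lemma semidirect_hom:
  assumes "group K" and f: "f \<in> hom N K" and g: "g \<in> hom H K"
    and act: "\<And>n h. n \<in> carrier N \<Longrightarrow> h \<in> carrier H \<Longrightarrow> \<alpha> h n \<in> carrier N"
    and comm: "\<And>n h. n \<in> carrier N \<Longrightarrow> h \<in> carrier H \<Longrightarrow> f (\<alpha> h n) \<otimes>\<^bsub>K\<^esub> g h = g h \<otimes>\<^bsub>K\<^esub> f n"
  shows "(\<lambda>(n, h). f n \<otimes>\<^bsub>K\<^esub> g h) \<in> hom (semidirect N H \<alpha>) K"
proof -
  interpret K: group K by (rule assms(1))
  have fc: "f x \<in> carrier K" if "x \<in> carrier N" for x using f that by (rule hom_in_carrier)
  have gc: "g y \<in> carrier K" if "y \<in> carrier H" for y using g that by (rule hom_in_carrier)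
  have "f n \<otimes>\<^bsub>K\<^esub> f (\<alpha> h n') \<otimes>\<^bsub>K\<^esub> (g h \<otimes>\<^bsub>K\<^esub> g h') = f n \<otimes>\<^bsub>K\<^esub> g h \<otimes>\<^bsub>K\<^esub> (f n' \<otimes>\<^bsub>K\<^esub> g h')"
    if "n \<in> carrier N" "n' \<in> carrier N" "h \<in> carrier H" "h' \<in> carrier H" for n n' h h'
  proof -
    have "f n \<otimes>\<^bsub>K\<^esub> f (\<alpha> h n') \<otimes>\<^bsub>K\<^esub> (g h \<otimes>\<^bsub>K\<^esub> g h') = f n \<otimes>\<^bsub>K\<^esub> (f (\<alpha> h n') \<otimes>\<^bsub>K\<^esub> g h) \<otimes>\<^bsub>K\<^esub> g h'"
      using that by (simp add: K.m_assoc fc gc act)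
    then show ?thesis using that by (simp add: comm K.m_assoc fc gc)
  qed
  then show ?thesis
    by (auto simp: hom_def semidirect_def fc gc act hom_mult[OF f] hom_mult[OF g])
qed

lemma involution_hom:
  assumes "group K" "T \<in> carrier K" "T \<otimes>\<^bsub>K\<^esub> T = \<one>\<^bsub>K\<^esub>"
  shows "(\<lambda>k. if k = 0 then \<one>\<^bsub>K\<^esub> else T) \<in> hom (integer_mod_group 2) K"
proof -
  interpret group K by (rule assms(1))
  have [simp]: "k \<in> carrier (integer_mod_group 2) \<longleftrightarrow> k = 0 \<or> k = 1" for k
    by (auto simp: carrier_integer_mod_group)
  show ?thesis using assms by (auto simp: hom_def)
qed

text \<open>
  Von Dyck's theorem for the presentation of \<open>y(m)\<close>: the homomorphism on the free product kills the
  relators, hence their normal closure.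
\<close>

lemma y_group_universal:
  assumes m: "2 \<le> m" and K: "group K" and A: "A \<in> carrier K" and S: "S \<in> hom (Sym m) K"
    and comm: "\<And>k :: int. commutator K (S (Transposition.transpose 1 2))
      (conj_by K (S (Transposition.transpose 1 2)) (A [^]\<^bsub>K\<^esub> k)) = \<one>\<^bsub>K\<^esub>"
    and conj: "\<And>i. 2 \<le> i \<Longrightarrow> i < m \<Longrightarrow>
      conj_by K A (S (Transposition.transpose i (i + 1))) = inv\<^bsub>K\<^esub> A"
  obtains \<psi> where "\<psi> \<in> hom (y_group m) K" "\<psi> (y_a m) = A"
    "\<And>p. p permutes {1..m} \<Longrightarrow> \<psi> (y_perm m p) = S p"
proof -
  interpret K: group K by (rule K)
  have pow: "(\<lambda>k. A [^]\<^bsub>K\<^esub> k) \<in> hom integer_group K" by (rule K.hom_integer_group_pow[OF A])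
  obtain h where h: "h \<in> hom (ZS m) K"
    and hL: "\<And>k. h (fp_class integer_group (Sym m) [Inl k]) = A [^]\<^bsub>K\<^esub> k"
    and hR: "\<And>p. p \<in> carrier (Sym m) \<Longrightarrow> h (fp_class integer_group (Sym m) [Inr p]) = S p"
    by (rule free_product_universal[OF group_integer_group group_Sym K pow S]) auto
  interpret h: group_hom "ZS m" K h
    by (intro group_hom.intro group_hom_axioms.intro group_ZS K h)
  have ha: "h (free_a m) = A" using A by (simp add: free_a_def hL)
  have hp: "h (free_perm m p) = S p" if "p permutes {1..m}" for p
  proof -
    have "p \<in> carrier (Sym m)" using that by (simp add: Sym_def sym_group_def)
    then show ?thesis by (simp add: free_perm_def hR)
  qed
  have hs: "h (free_s m i) = S (Transposition.transpose i (i + 1))" if "1 \<le> i" "i < m" for i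
    using that by (simp add: free_s_def hp permutes_swap_id)
  note closed = free_a_closed[of m] free_s_closed[of _ m]
  have "y_relators m \<subseteq> kernel (ZS m) K h"
  proof
    fix r assume r: "r \<in> y_relators m"
    then have rc: "r \<in> carrier (ZS m)" using y_relators_closed[OF m] by blast
    from r consider (comm) k :: int where
        "r = commutator (ZS m) (free_s m 1) (conj_by (ZS m) (free_s m 1) (free_a m [^]\<^bsub>ZS m\<^esub> k))"
      | (conj) i where "2 \<le> i" "i \<le> m - 1"
        "r = conj_by (ZS m) (free_a m) (free_s m i) \<otimes>\<^bsub>ZS m\<^esub> inv\<^bsub>ZS m\<^esub> (inv\<^bsub>ZS m\<^esub> (free_a m))"
      unfolding y_relators_def by blast
    then have "h r = \<one>\<^bsub>K\<^esub>"
    proof cases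
      case comm
      have s: "free_s m 1 \<in> carrier (ZS m)" using closed m by simp
      moreover have "conj_by (ZS m) (free_s m 1) (free_a m [^]\<^bsub>ZS m\<^esub> k) \<in> carrier (ZS m)"
        using s closed by (simp add: conj_by_def)
      moreover have "h (free_s m 1) = S (Transposition.transpose 1 2)" using hs[of 1] m by (simp add: numeral_2_eq_2)
      ultimately show ?thesis
        using closed(1) assms(5)[of k]
        by (simp only: comm h.hom_commutator h.hom_conj_by h.hom_int_pow ha h.G.int_pow_closed)
    next
      case conj
      then have s: "free_s m i \<in> carrier (ZS m)" using closed by simp
      then have "conj_by (ZS m) (free_a m) (free_s m i) \<in> carrier (ZS m)"
        using closed by (simp add: conj_by_def)
      then have "h r = conj_by K A (S (Transposition.transpose i (i + 1))) \<otimes>\<^bsub>K\<^esub> inv\<^bsub>K\<^esub> (inv\<^bsub>K\<^esub> A)"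
        using closed(1) s conj A by (simp add: h.hom_conj_by ha hs)
      then show ?thesis using conj assms(6)[of i] A by simp
    qed
    then show "r \<in> kernel (ZS m) K h" using rc by (simp add: kernel_def)
  qed
  then have "y_kernel m \<subseteq> kernel (ZS m) K h"
    unfolding y_kernel_def by (intro normal_closure_least h.normal_kernel)
  then obtain \<psi> where \<psi>: "\<psi> \<in> hom (ZS m Mod y_kernel m) K"
    "\<And>x. x \<in> carrier (ZS m) \<Longrightarrow> \<psi> (y_kernel m #>\<^bsub>ZS m\<^esub> x) = h x"
    using h.FactGroup_universal_kernel[OF y_kernel_normal[OF m]] by metis
  show thesis
    by (rule that[of \<psi>]) (simp_all add: \<psi> y_group_def y_a_def y_perm_def ha hp free_a_closed free_perm_closed)
qed

lemma y_group_hom_eqI: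
  assumes m: "2 \<le> m" and K: "group K"
    and \<psi>: "\<psi> \<in> hom (y_group m) K" and \<chi>: "\<chi> \<in> hom (y_group m) K"
    and a: "\<psi> (y_a m) = \<chi> (y_a m)"
    and perm: "\<And>p. p permutes {1..m} \<Longrightarrow> \<psi> (y_perm m p) = \<chi> (y_perm m p)"
    and n: "n \<in> carrier (y_group m)"
  shows "\<psi> n = \<chi> n"
proof -
  let ?c = "\<lambda>x. y_kernel m #>\<^bsub>ZS m\<^esub> x"
  have c: "?c \<in> hom (ZS m) (y_group m)"
    unfolding y_group_def by (rule normal.r_coset_hom_Mod[OF y_kernel_normal[OF m]])
  have int_gen: "f (fp_class integer_group (Sym m) [Inl k]) = f (free_a m) [^]\<^bsub>K\<^esub> k"
    if "f \<in> hom (ZS m) K" for f k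
  proof -
    have "f \<circ> (\<lambda>k. fp_class integer_group (Sym m) [Inl k]) \<in> hom integer_group K"
      using fp_inl_hom[OF group_integer_group group_Sym] that by (rule hom_compose)
    then interpret g: group_hom integer_group K "f \<circ> (\<lambda>k. fp_class integer_group (Sym m) [Inl k])"
      by (intro group_hom.intro group_hom_axioms.intro group_integer_group K)
    show ?thesis using g.hom_int_pow[of 1 k] by (simp add: free_a_def)
  qed
  have hc: "\<psi> \<circ> ?c \<in> hom (ZS m) K" "\<chi> \<circ> ?c \<in> hom (ZS m) K"
    using c \<psi> \<chi> by (auto intro: hom_compose)
  have "(\<psi> \<circ> ?c) x = (\<chi> \<circ> ?c) x" if "x \<in> carrier (ZS m)" for x
    using group_integer_group group_Sym K hc _ _ that
  proof (rule free_product_hom_eqI)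
    show "(\<psi> \<circ> ?c) (fp_class integer_group (Sym m) [Inl k]) = (\<chi> \<circ> ?c) (fp_class integer_group (Sym m) [Inl k])"
      for k using a by (simp only: int_gen hc) (simp add: y_a_def)
    show "(\<psi> \<circ> ?c) (fp_class integer_group (Sym m) [Inr p]) = (\<chi> \<circ> ?c) (fp_class integer_group (Sym m) [Inr p])"
      if "p \<in> carrier (Sym m)" for p
      using perm[of p] that by (simp add: y_perm_def free_perm_def Sym_def sym_group_def)
  qed
  then show ?thesis using n by (auto simp: y_group_def carrier_FactGroup)
qed

lemma y_a_closed: "2 \<le> m \<Longrightarrow> y_a m \<in> carrier (y_group m)"
  by (auto simp: y_a_def y_group_def carrier_FactGroup free_a_closed)

lemma y_perm_closed: "2 \<le> m \<Longrightarrow> p permutes {1..m} \<Longrightarrow> y_perm m p \<in> carrier (y_group m)"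
  by (auto simp: y_perm_def y_group_def carrier_FactGroup free_perm_closed)

text \<open>
  The compatibility of \<open>T\<close> with the flip of \<open>y(m)\<close> compares two homomorphisms, \<open>n \<mapsto> \<psi> (y_flip n)\<close>
  and \<open>n \<mapsto> T (\<psi> n) T\<close>, so it is enough to have it on \<open>a\<close> and on permutations.
\<close>

lemma yt_group_universal:
  assumes m: "2 \<le> m" and K: "group K" and A: "A \<in> carrier K" and S: "S \<in> hom (Sym m) K"
    and comm: "\<And>k :: int. commutator K (S (Transposition.transpose 1 2))
      (conj_by K (S (Transposition.transpose 1 2)) (A [^]\<^bsub>K\<^esub> k)) = \<one>\<^bsub>K\<^esub>"
    and conj: "\<And>i. 2 \<le> i \<Longrightarrow> i < m \<Longrightarrow>
      conj_by K A (S (Transposition.transpose i (i + 1))) = inv\<^bsub>K\<^esub> A"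
    and T: "T \<in> carrier K" and TT: "T \<otimes>\<^bsub>K\<^esub> T = \<one>\<^bsub>K\<^esub>"
    and TA: "T \<otimes>\<^bsub>K\<^esub> A = inv\<^bsub>K\<^esub> A \<otimes>\<^bsub>K\<^esub> T"
    and TS: "\<And>p. p permutes {1..m} \<Longrightarrow> T \<otimes>\<^bsub>K\<^esub> S p = S p \<otimes>\<^bsub>K\<^esub> T"
  obtains \<phi> where "\<phi> \<in> hom (yt_group m) K" "\<phi> (yt_tau m) = T" "\<phi> (yt_a m) = A"
    "\<And>p. p permutes {1..m} \<Longrightarrow> \<phi> (yt_incl m (y_perm m p)) = S p"
proof -
  interpret K: group K by (rule K)
  obtain \<psi> where \<psi>: "\<psi> \<in> hom (y_group m) K" and \<psi>a: "\<psi> (y_a m) = A"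
    and \<psi>p: "\<And>p. p permutes {1..m} \<Longrightarrow> \<psi> (y_perm m p) = S p"
    by (rule y_group_universal[OF m K A S comm conj]) auto
  interpret \<psi>: group_hom "y_group m" K \<psi>
    by (intro group_hom.intro group_hom_axioms.intro group_y_group m K \<psi>)
  have invT: "inv\<^bsub>K\<^esub> T = T" using T TT by (simp add: K.inv_equality)
  have Sc: "S p \<in> carrier K" if "p permutes {1..m}" for p
    using hom_in_carrier[OF S] that by (simp add: Sym_def sym_group_def)
  have TT': "T \<otimes>\<^bsub>K\<^esub> (T \<otimes>\<^bsub>K\<^esub> x) = x" if "x \<in> carrier K" for x
    using T TT that by (simp flip: K.m_assoc)
  have flip: "y_flip \<in> hom (y_group m) (y_group m)" using y_flip_iso[OF m] by (simp add: iso_def)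
  have twist: "\<psi> (y_flip n) \<otimes>\<^bsub>K\<^esub> T = T \<otimes>\<^bsub>K\<^esub> \<psi> n" if n: "n \<in> carrier (y_group m)" for n
  proof -
    have "(\<psi> \<circ> y_flip) n = (\<lambda>n. T \<otimes>\<^bsub>K\<^esub> \<psi> n \<otimes>\<^bsub>K\<^esub> T) n"
      using m K _ _ _ _ n
    proof (rule y_group_hom_eqI)
      show "\<psi> \<circ> y_flip \<in> hom (y_group m) K" using flip \<psi> by (rule hom_compose)
      show "(\<lambda>n. T \<otimes>\<^bsub>K\<^esub> \<psi> n \<otimes>\<^bsub>K\<^esub> T) \<in> hom (y_group m) K"
        using T by (auto simp: hom_def K.m_assoc TT')
      show "(\<psi> \<circ> y_flip) (y_a m) = T \<otimes>\<^bsub>K\<^esub> \<psi> (y_a m) \<otimes>\<^bsub>K\<^esub> T"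
        using m T A TT by (simp add: y_flip_a y_a_closed \<psi>a TA K.m_assoc)
      show "(\<psi> \<circ> y_flip) (y_perm m p) = T \<otimes>\<^bsub>K\<^esub> \<psi> (y_perm m p) \<otimes>\<^bsub>K\<^esub> T"
        if "p permutes {1..m}" for p
        using m T that Sc[OF that] TT by (simp add: y_flip_perm \<psi>p TS K.m_assoc)
    qed
    then show ?thesis using n T TT by (simp add: K.m_assoc)
  qed
  let ?g = "\<lambda>k :: int. if k = 0 then \<one>\<^bsub>K\<^esub> else T"
  have g: "?g \<in> hom (integer_mod_group 2) K" by (rule involution_hom[OF K T TT])
  have "(\<lambda>(n, k). \<psi> n \<otimes>\<^bsub>K\<^esub> ?g k) \<in> hom (yt_group m) K"
    unfolding yt_group_def
    by (rule semidirect_hom[OF K \<psi> g]) (auto simp: hom_in_carrier[OF flip] twist)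
  then show thesis
    by (rule that)
      (use m T A in \<open>simp_all add: yt_tau_def yt_a_def yt_incl_def \<psi>a \<psi>p Sc\<close>)
qed


section \<open>Transvections and Eichler transformations\<close>

lemma laurent_two: "(2 :: laurent) = 0"
  using laurent_add_self[of 1] by simp

lemma vec_add_self: "x + x = (0 :: vec)"
  by (rule ext) (simp add: laurent_two)

lemma scal_simps:
  "scal (a + b) x = scal a x + scal b x" "scal c (x + y) = scal c x + scal c y"
  "scal a (scal b x) = scal (a * b) x" "scal 1 x = x" "scal 0 x = 0"
  by (auto simp: scal_def fun_eq_iff algebra_simps)

lemma bil_commute: "bil m x y = bil m y x"
  by (simp add: bil_split add.commute)

lemma mult_orthogonal_group: "f \<otimes>\<^bsub>orthogonal_group m\<^esub> g = compose (V m) g f"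
  by (simp add: orthogonal_group_def)

lemma one_orthogonal_group: "\<one>\<^bsub>orthogonal_group m\<^esub> = (\<lambda>x\<in>V m. x)"
  by (simp add: orthogonal_group_def)

lemma orthogonal_mult_apply: "x \<in> V m \<Longrightarrow> (f \<otimes>\<^bsub>orthogonal_group m\<^esub> g) x = g (f x)"
  by (simp add: mult_orthogonal_group compose_eq)

context
  fixes m f assumes f: "f \<in> carrier (orthogonal_group m)"
begin

lemma orthogonal_closed: "x \<in> V m \<Longrightarrow> f x \<in> V m"
  using f by (auto simp: orthogonal_group_def Bij_def bij_betw_def)

lemma orthogonal_add: "x \<in> V m \<Longrightarrow> y \<in> V m \<Longrightarrow> f (x + y) = f x + f y"
  using f by (auto simp: orthogonal_group_def)

lemma orthogonal_scal: "x \<in> V m \<Longrightarrow> f (scal c x) = scal c (f x)"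
  using f by (auto simp: orthogonal_group_def)

lemma orthogonal_q: "x \<in> V m \<Longrightarrow> q m (f x) = q m x"
  using f by (auto simp: orthogonal_group_def)

text \<open>The bilinear form is the polarisation of \<open>q\<close>.\<close>

lemma orthogonal_bil:
  assumes "x \<in> V m" "y \<in> V m"
  shows "bil m (f x) (f y) = bil m x y"
proof -
  have "q m (f x + f y) = q m (x + y)"
    using orthogonal_q[of "x + y"] assms by (simp add: orthogonal_add V_closed)
  then show ?thesis using assms by (simp add: q_add orthogonal_q)
qed

lemma orthogonal_extensional: "f \<in> extensional (V m)"
  using f by (auto simp: orthogonal_group_def Bij_def)

end

lemma orthogonal_eqI:
  assumes "f \<in> carrier (orthogonal_group m)" "g \<in> carrier (orthogonal_group m)"
    and "\<And>x. x \<in> V m \<Longrightarrow> f x = g x"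
  shows "f = g"
  using assms orthogonal_extensional by (metis extensionalityI)

lemma orthogonalI_involution:
  assumes "f \<in> extensional (V m)" "\<And>x. x \<in> V m \<Longrightarrow> f x \<in> V m" "\<And>x. x \<in> V m \<Longrightarrow> f (f x) = x"
    and "\<And>x y. x \<in> V m \<Longrightarrow> y \<in> V m \<Longrightarrow> f (x + y) = f x + f y"
    and "\<And>c x. x \<in> V m \<Longrightarrow> f (scal c x) = scal c (f x)"
    and "\<And>x. x \<in> V m \<Longrightarrow> q m (f x) = q m x"
  shows "f \<in> carrier (orthogonal_group m)"
proof -
  have "bij_betw f (V m) (V m)"
    by (rule bij_betw_byWitness[where f' = f]) (use assms in auto)
  then show ?thesis using assms by (auto simp: orthogonal_group_def Bij_def)
qed

lemma transvection_apply: "x \<in> V m \<Longrightarrow> transvection m w x = x + scal (bil m x w * unit_inv (q m w)) w"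
  by (simp add: transvection_def)

lemma
  assumes w: "w \<in> V m" and unit: "q m w dvd 1"
  shows transvection_orthogonal: "transvection m w \<in> carrier (orthogonal_group m)"
    and transvection_involution:
      "transvection m w \<otimes>\<^bsub>orthogonal_group m\<^esub> transvection m w = \<one>\<^bsub>orthogonal_group m\<^esub>"
proof -
  define d where "d = unit_inv (q m w)"
  obtain d' where "q m w * d' = 1" using unit by (metis dvdE)
  then have qd: "q m w * d = 1" unfolding d_def by (simp add: unit_inv_eq)
  have r: "transvection m w x = x + scal (bil m x w * d) w" if "x \<in> V m" for x
    using that by (simp add: transvection_apply d_def)
  have rV: "transvection m w x \<in> V m" if "x \<in> V m" for x using that w by (simp add: r V_closed)
  have rr: "transvection m w (transvection m w x) = x" if "x \<in> V m" for x
  proof -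
    have "transvection m w (transvection m w x) = x + (scal (bil m x w * d) w + scal (bil m x w * d) w)"
      using that rV[OF that]
      by (simp add: r bil_add bil_scal bil_alternating V_closed w add.assoc)
    then show ?thesis by (simp add: vec_add_self)
  qed
  show "transvection m w \<in> carrier (orthogonal_group m)"
  proof (rule orthogonalI_involution)
    show "transvection m w \<in> extensional (V m)" by (simp add: transvection_def)
    show "q m (transvection m w x) = q m x" if "x \<in> V m" for x
    proof -
      define b where "b = bil m x w"
      have "q m (transvection m w x) = q m x + (b ^ 2 * d * (q m w * d) + b ^ 2 * d)"
        using that by (simp add: r q_add q_scal bil_scal b_def[symmetric] power2_eq_square ac_simps)
      then show ?thesis by (simp add: qd laurent_add_self)
    qed
    show "transvection m w (x + y) = transvection m w x + transvection m w y"
      if "x \<in> V m" "y \<in> V m" for x y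
      using that by (simp add: r V_closed bil_add scal_simps algebra_simps)
    show "transvection m w (scal c x) = scal c (transvection m w x)" if "x \<in> V m" for c x
      using that by (simp add: r V_closed bil_scal scal_simps ac_simps)
  qed (fact rV rr)+
  show "transvection m w \<otimes>\<^bsub>orthogonal_group m\<^esub> transvection m w = \<one>\<^bsub>orthogonal_group m\<^esub>"
    by (auto simp: one_orthogonal_group mult_orthogonal_group compose_def rr)
qed

text \<open>
  Transvections are defined in terms of the forms alone, so an isometry \<open>g\<close> conjugates the one in
  \<open>w\<close> to the one in the image of \<open>w\<close>.
\<close>

lemma transvection_orthogonal_commute:
  assumes g: "g \<in> carrier (orthogonal_group m)" and w: "w \<in> V m"
  shows "transvection m w \<otimes>\<^bsub>orthogonal_group m\<^esub> g = g \<otimes>\<^bsub>orthogonal_group m\<^esub> transvection m (g w)"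
proof -
  have "g (transvection m w x) = transvection m (g w) (g x)" if "x \<in> V m" for x
    using that w by (simp add: transvection_apply orthogonal_closed[OF g] orthogonal_add[OF g]
        orthogonal_scal[OF g] orthogonal_bil[OF g] orthogonal_q[OF g] V_closed)
  then show ?thesis by (auto simp: mult_orthogonal_group compose_def)
qed

text \<open>
  The Eichler (or Siegel) transformation with centre \<open>e\<close>; it is an isometry when \<open>e\<close> is singular and
  orthogonal to \<open>w\<close>.
\<close>

definition eichler :: "nat \<Rightarrow> vec \<Rightarrow> vec \<Rightarrow> vec \<Rightarrow> vec"
  where "eichler m e w =
    (\<lambda>x\<in>V m. x + scal (bil m x e) w + scal (bil m x w) e + scal (q m w * bil m x e) e)"

lemma transvection_mult_eq_eichler:
  assumes "w \<in> V m" "e \<in> V m" "q m w = 1" "q m e = 0" "bil m w e = 0"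
  shows "transvection m w \<otimes>\<^bsub>orthogonal_group m\<^esub> transvection m (w + e) = eichler m e w"
proof -
  have q: "q m (w + e) = 1" using assms by (simp add: q_add)
  have one: "unit_inv 1 = 1" by (rule unit_inv_eq) simp
  have "transvection m (w + e) (transvection m w x) = eichler m e w x" if x: "x \<in> V m" for x
  proof -
    have "transvection m (w + e) (transvection m w x)
        = x + scal (bil m x w) w + scal (bil m x w + bil m x e) (w + e)"
      using assms x q one
      by (simp add: transvection_apply V_closed bil_add bil_scal bil_alternating)
    also have "\<dots> = x + scal (bil m x e) w + scal (bil m x w) e + scal (bil m x e) e
        + (scal (bil m x w) w + scal (bil m x w) w)"
      by (simp add: scal_simps algebra_simps)
    finally show ?thesis using x assms by (simp add: eichler_def vec_add_self)
  qed
  then show ?thesis by (auto simp: mult_orthogonal_group compose_def eichler_def)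
qed

lemma eichler_orthogonal:
  assumes "w \<in> V m" "e \<in> V m" "q m w = 1" "q m e = 0" "bil m w e = 0"
  shows "eichler m e w \<in> carrier (orthogonal_group m)"
  using assms group.is_monoid[OF group_orthogonal_group]
  by (auto simp: q_add V_closed simp flip: transvection_mult_eq_eichler
      intro!: monoid.m_closed transvection_orthogonal)

text \<open>
  The transformation does not change the product of a vector with \<open>e\<close>, so the two shifts add up; the
  coefficient of \<open>e\<close> collects \<open>q w + q w' + bil w w' = q (w + w')\<close>.
\<close>

lemma eichler_mult:
  assumes "e \<in> V m" "w \<in> V m" "w' \<in> V m" "q m e = 0" "bil m w e = 0" "bil m w' e = 0"
  shows "eichler m e w \<otimes>\<^bsub>orthogonal_group m\<^esub> eichler m e w' = eichler m e (w + w')"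
proof -
  have ew: "bil m e w = 0" "bil m e w' = 0" using assms by (simp_all add: bil_commute)
  have "eichler m e w' (eichler m e w x) = eichler m e (w + w') x" if "x \<in> V m" for x
    using that assms ew
    by (simp add: eichler_def V_closed bil_add bil_scal bil_alternating scal_simps q_add algebra_simps)
  then show ?thesis
    by (intro extensionalityI[of _ "V m"])
      (simp_all add: orthogonal_mult_apply, simp_all add: mult_orthogonal_group eichler_def)
qed

lemma eichler_orthogonal_commute:
  assumes g: "g \<in> carrier (orthogonal_group m)" and "e \<in> V m" "w \<in> V m"
  shows "eichler m e w \<otimes>\<^bsub>orthogonal_group m\<^esub> g = g \<otimes>\<^bsub>orthogonal_group m\<^esub> eichler m (g e) (g w)"
proof -
  have "g (eichler m e w x) = eichler m (g e) (g w) (g x)" if "x \<in> V m" for x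
    using that assms(2,3) by (simp add: eichler_def orthogonal_closed[OF g] orthogonal_add[OF g]
        orthogonal_scal[OF g] orthogonal_bil[OF g] orthogonal_q[OF g] V_closed)
  then show ?thesis by (auto simp: mult_orthogonal_group compose_def eichler_def)
qed

lemma stabiliser_subgroup:
  assumes "e \<in> V m"
  shows "subgroup {g \<in> carrier (orthogonal_group m). g e = e} (orthogonal_group m)"
proof -
  interpret G: group "orthogonal_group m" by (rule group_orthogonal_group)
  show ?thesis
  proof (rule G.subgroupI)
    show "{g \<in> carrier (orthogonal_group m). g e = e} \<noteq> {}"
      using assms by (auto intro!: exI[of _ "\<one>\<^bsub>orthogonal_group m\<^esub>"] simp: one_orthogonal_group)
  next
    fix g assume g: "g \<in> {g \<in> carrier (orthogonal_group m). g e = e}"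
    have "(g \<otimes>\<^bsub>orthogonal_group m\<^esub> inv\<^bsub>orthogonal_group m\<^esub> g) e = e"
      using g assms by (simp add: one_orthogonal_group)
    then show "inv\<^bsub>orthogonal_group m\<^esub> g \<in> {g \<in> carrier (orthogonal_group m). g e = e}"
      using g assms by (simp add: orthogonal_mult_apply)
  qed (auto simp: orthogonal_mult_apply assms)
qed


section \<open>The symmetric group acting on the basis\<close>

text \<open>
  Composing a coordinate function with the inverse of \<open>p\<close> moves the basis vector \<open>v\<^sub>i\<close> to
  \<open>v\<^sub>p\<^sub>i\<close>; see \<open>perm_act_v\<close>. Coordinate \<open>0\<close>, that of \<open>u\<close>, is untouched.
\<close>

definition perm_act :: "nat \<Rightarrow> (nat \<Rightarrow> nat) \<Rightarrow> vec \<Rightarrow> vec"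
  where "perm_act m p = (\<lambda>x\<in>V m. x \<circ> Hilbert_Choice.inv p)"

lemma perm_act_id: "perm_act m id = \<one>\<^bsub>orthogonal_group m\<^esub>"
  by (auto simp: perm_act_def one_orthogonal_group)

lemma comp_inv_V:
  assumes "p permutes {1..m}" "x \<in> V m"
  shows "x \<circ> Hilbert_Choice.inv p \<in> V m"
  using permutes_not_in[OF permutes_inv[OF assms(1)]] assms(2) by (auto simp: V_def)

lemma perm_act_mult:
  assumes p: "p permutes {1..m}" and p': "p' permutes {1..m}"
  shows "perm_act m p \<otimes>\<^bsub>orthogonal_group m\<^esub> perm_act m p' = perm_act m (p' \<circ> p)"
  using p p' by (auto simp: mult_orthogonal_group compose_def perm_act_def comp_inv_V
      o_inv_distrib permutes_bij o_assoc intro!: restrict_ext)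

lemma bil_v:
  assumes "i \<le> m"
  shows "bil m x (v i) = (\<Sum>k\<le>m. x k) + x i"
proof -
  have "bil m x (v i) = (\<Sum>k\<le>m. if k = i then 0 else x k)"
    unfolding bil_def v_def using assms by (intro sum.cong) (auto simp: if_distrib cong: if_cong)
  also have "\<dots> = (\<Sum>k\<in>{..m} - {i}. x k)"
    by (rule sum.mono_neutral_cong_right) auto
  also have "\<dots> = (\<Sum>k\<le>m. x k) + x i"
    using assms by (simp add: sum.remove[of "{..m}" i] add.commute add.left_commute laurent_two)
  finally show ?thesis .
qed

lemma q_v_add:
  assumes "1 \<le> i" "i \<le> m" "1 \<le> j" "j \<le> m" "i \<noteq> j"
  shows "q m (v i + v j) = 1"
  using assms by (simp add: q_add q_basis bil_basis laurent_add_self)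

text \<open>
  In characteristic 2 the product of \<open>x\<close> with \<open>v\<^sub>i + v\<^sub>j\<close> is \<open>x\<^sub>i + x\<^sub>j\<close>, and adding this to both
  coordinates \<open>i\<close> and \<open>j\<close> exchanges them.
\<close>

lemma transvection_eq_perm_act:
  assumes "1 \<le> i" "i \<le> m" "1 \<le> j" "j \<le> m" "i \<noteq> j"
  shows "transvection m (v i + v j) = perm_act m (Transposition.transpose i j)"
proof -
  have one: "unit_inv 1 = 1" by (rule unit_inv_eq) simp
  have "transvection m (v i + v j) x = perm_act m (Transposition.transpose i j) x"
    if x: "x \<in> V m" for x
  proof -
    have b: "bil m x (v i + v j) = x i + x j"
    proof -
      have "bil m x (v i + v j) = x i + x j + ((\<Sum>k\<le>m. x k) + (\<Sum>k\<le>m. x k))"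
        using assms by (simp add: bil_add bil_v algebra_simps)
      then show ?thesis by (simp add: laurent_add_self)
    qed
    have cancel: "a + (a + b) = b" "a + (b + a) = b" for a b :: laurent
      by (simp_all add: laurent_two add.left_commute)
    have "transvection m (v i + v j) x = x + scal (x i + x j) (v i + v j)"
      using x assms by (simp add: transvection_apply q_v_add one b)
    also have "\<dots> = x \<circ> Transposition.transpose i j"
      using assms(5)
      by (auto simp: scal_def v_def fun_eq_iff Transposition.transpose_def cancel)
    finally show ?thesis using x by (simp add: perm_act_def)
  qed
  then show ?thesis by (intro extensionalityI[of _ "V m"]) (auto simp: transvection_def perm_act_def)
qed

text \<open>
  Transpositions act as transvections, which are isometries, and they generate all permutations.
\<close>

lemma perm_act_orthogonal:
  assumes "p permutes {1..m}"
  shows "perm_act m p \<in> carrier (orthogonal_group m)"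
proof -
  interpret G: group "orthogonal_group m" by (rule group_orthogonal_group)
  show ?thesis using assms finite_atLeastAtMost
  proof (induction rule: permutes_induct)
    case id
    show ?case unfolding perm_act_id by (rule G.one_closed)
  next
    case (swap a b p)
    have "perm_act m (Transposition.transpose a b) \<in> carrier (orthogonal_group m)"
      using swap.hyps transvection_orthogonal[of "v a + v b" m]
      by (simp add: transvection_eq_perm_act q_v_add V_closed)
    with swap.IH have "perm_act m p \<otimes>\<^bsub>orthogonal_group m\<^esub> perm_act m (Transposition.transpose a b)
      \<in> carrier (orthogonal_group m)" by (rule G.m_closed)
    then show ?case
      using perm_act_mult[OF swap.hyps(4) permutes_swap_id[OF swap.hyps(1,2)]] by (simp only:)
  qed
qed

lemma perm_act_u:
  assumes "p permutes {1..m}"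
  shows "perm_act m p u = u"
proof -
  have "p 0 = 0" using permutes_not_in[OF assms, of 0] by simp
  then have "u \<circ> Hilbert_Choice.inv p = u"
    by (intro ext) (simp add: u_def permutes_inv_eq[OF assms])
  then show ?thesis by (simp add: perm_act_def V_closed)
qed

lemma perm_act_v:
  assumes "p permutes {1..m}" "1 \<le> i" "i \<le> m"
  shows "perm_act m p (v i) = v (p i)"
proof -
  have "perm_act m p (v i) = v i \<circ> Hilbert_Choice.inv p"
    using assms by (simp add: perm_act_def V_closed)
  also have "\<dots> = v (p i)"
    by (rule ext) (auto simp: v_def permutes_inv_eq[OF assms(1)])
  finally show ?thesis .
qed


section \<open>The images of the generators\<close>

lemma q_u_unit: "q m u dvd 1"
  by (simp add: q_basis)

lemma q_v_unit: "1 \<le> i \<Longrightarrow> i \<le> m \<Longrightarrow> q m (v i) dvd 1"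
  using t_inv_unit by (metis q_basis(2) dvd_triv_left)

lemma transvection_u_perm_act:
  assumes "p permutes {1..m}"
  shows "transvection m u \<otimes>\<^bsub>orthogonal_group m\<^esub> perm_act m p
    = perm_act m p \<otimes>\<^bsub>orthogonal_group m\<^esub> transvection m u"
  using transvection_orthogonal_commute[OF perm_act_orthogonal[OF assms], of u]
  by (simp add: perm_act_u[OF assms] V_closed)

definition signed_perm :: "nat \<Rightarrow> (nat \<Rightarrow> nat) \<Rightarrow> vec \<Rightarrow> vec"
  where "signed_perm m p = (if evenperm p then \<one>\<^bsub>orthogonal_group m\<^esub> else transvection m u)
    \<otimes>\<^bsub>orthogonal_group m\<^esub> perm_act m p"

text \<open>
  Both the parity factor and the permutation action are multiplicative, and they commute since
  permutations fix \<open>u\<close>.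
\<close>

lemma signed_perm_hom: "signed_perm m \<in> hom (Sym m) (orthogonal_group m)"
proof -
  interpret G: group "orthogonal_group m" by (rule group_orthogonal_group)
  note T = transvection_orthogonal[OF V_closed(1) q_u_unit, of m]
  note TT = transvection_involution[OF V_closed(1) q_u_unit, of m]
  show ?thesis
  proof (rule homI)
    fix p p' assume "p \<in> carrier (Sym m)" "p' \<in> carrier (Sym m)"
    then have p: "p permutes {1..m}" "p' permutes {1..m}" by (simp_all add: Sym_def sym_group_def)
    then have even: "evenperm (p' \<circ> p) \<longleftrightarrow> evenperm p = evenperm p'"
      using evenperm_comp permutation_permutes by (metis finite_atLeastAtMost)
    note P = perm_act_orthogonal[OF p(1)] perm_act_orthogonal[OF p(2)]
    have "transvection m u \<otimes>\<^bsub>orthogonal_group m\<^esub> (transvection m u \<otimes>\<^bsub>orthogonal_group m\<^esub> x) = x"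
      if "x \<in> carrier (orthogonal_group m)" for x
      using T TT that by (simp flip: G.m_assoc)
    moreover have "perm_act m p \<otimes>\<^bsub>orthogonal_group m\<^esub>
        (transvection m u \<otimes>\<^bsub>orthogonal_group m\<^esub> perm_act m p')
      = transvection m u \<otimes>\<^bsub>orthogonal_group m\<^esub> perm_act m (p' \<circ> p)"
      using P T by (simp add: transvection_u_perm_act[OF p(1), symmetric]
          flip: G.m_assoc perm_act_mult[OF p])
    ultimately show "signed_perm m (p \<otimes>\<^bsub>Sym m\<^esub> p')
        = signed_perm m p \<otimes>\<^bsub>orthogonal_group m\<^esub> signed_perm m p'"
      using P T p even G.m_closed[OF P]
      by (simp add: signed_perm_def Sym_def perm_act_mult G.m_assoc)
  qed (use T perm_act_orthogonal in \<open>auto simp: signed_perm_def Sym_def sym_group_def\<close>)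
qed

lemma signed_perm_transpose:
  assumes "1 \<le> i" "i \<le> m" "1 \<le> j" "j \<le> m" "i \<noteq> j"
  shows "signed_perm m (Transposition.transpose i j)
    = transvection m u \<otimes>\<^bsub>orthogonal_group m\<^esub> transvection m (v i + v j)"
  using assms by (simp add: signed_perm_def evenperm_swap transvection_eq_perm_act)

theorem proposition3p2:
  fixes m :: nat
  assumes "m \<ge> 2"
  shows "\<exists>\<phi>. \<phi> \<in> hom (yt_group m) (orthogonal_group m) \<and>
    \<phi> (yt_tau m) = transvection m u \<and>
    \<phi> (yt_a m) = transvection m u \<otimes>\<^bsub>orthogonal_group m\<^esub> transvection m (v 1) \<and>
    (\<forall>i. 1 \<le> i \<and> i \<le> m - 1 \<longrightarrow> \<phi> (yt_s m i) = transvection m (v i + v (i + 1)))"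
proof -
  interpret G: group "orthogonal_group m" by (rule group_orthogonal_group)
  let ?G = "orthogonal_group m"
  define T where "T = transvection m u"
  define B where "B = transvection m (v 1)"
  define A where "A = T \<otimes>\<^bsub>?G\<^esub> B"
  note m = assms
  have v1: "v 1 \<in> V m" using m by (simp add: V_closed)
  have T: "T \<in> carrier ?G" "T \<otimes>\<^bsub>?G\<^esub> T = \<one>\<^bsub>?G\<^esub>"
    unfolding T_def by (intro transvection_orthogonal transvection_involution V_closed q_u_unit)+
  have "q m (v 1) dvd 1" using m by (intro q_v_unit) auto
  then have B: "B \<in> carrier ?G" "B \<otimes>\<^bsub>?G\<^esub> B = \<one>\<^bsub>?G\<^esub>"
    using transvection_orthogonal[OF v1] transvection_involution[OF v1]
    by (simp_all add: B_def)
  have A: "A \<in> carrier ?G" unfolding A_def by (intro G.m_closed T B)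
  have invA: "inv\<^bsub>?G\<^esub> A = B \<otimes>\<^bsub>?G\<^esub> T"
    using T B by (simp add: A_def G.inv_mult_group G.inv_equality)
  have TA: "T \<otimes>\<^bsub>?G\<^esub> A = inv\<^bsub>?G\<^esub> A \<otimes>\<^bsub>?G\<^esub> T"
    using T B by (simp add: invA G.m_assoc) (simp add: A_def flip: G.m_assoc)
  have TS: "T \<otimes>\<^bsub>?G\<^esub> signed_perm m p = signed_perm m p \<otimes>\<^bsub>?G\<^esub> T" if p: "p permutes {1..m}" for p
    using T perm_act_orthogonal[OF p] transvection_u_perm_act[OF p, folded T_def]
    by (simp add: signed_perm_def T_def[symmetric] G.m_assoc)
  have conj: "conj_by ?G A (signed_perm m (Transposition.transpose i (i + 1))) = inv\<^bsub>?G\<^esub> A"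
    if i: "2 \<le> i" "i < m" for i
  proof -
    define P where "P = perm_act m (Transposition.transpose i (i + 1))"
    have p: "Transposition.transpose i (i + 1) permutes {1..m}"
      using i by (intro permutes_swap_id) auto
    have P: "P \<in> carrier ?G" unfolding P_def by (rule perm_act_orthogonal[OF p])
    have S: "signed_perm m (Transposition.transpose i (i + 1)) = T \<otimes>\<^bsub>?G\<^esub> P"
      by (simp add: signed_perm_def evenperm_swap T_def P_def)
    have TP: "T \<otimes>\<^bsub>?G\<^esub> P = P \<otimes>\<^bsub>?G\<^esub> T"
      unfolding T_def P_def by (rule transvection_u_perm_act[OF p])
    have "P (v 1) = v 1" using i perm_act_v[OF p, of 1] by (simp add: P_def)
    then have BP: "B \<otimes>\<^bsub>?G\<^esub> P = P \<otimes>\<^bsub>?G\<^esub> B"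
      using transvection_orthogonal_commute[OF P v1] by (simp add: B_def)
    \<comment> \<open>\<open>P\<close> commutes with \<open>T\<close> and \<open>B\<close>, and \<open>T\<close> reverses \<open>A = T B\<close>.\<close>
    have "A \<otimes>\<^bsub>?G\<^esub> (T \<otimes>\<^bsub>?G\<^esub> P) = (T \<otimes>\<^bsub>?G\<^esub> B) \<otimes>\<^bsub>?G\<^esub> (P \<otimes>\<^bsub>?G\<^esub> T)" by (simp add: A_def TP)
    also have "\<dots> = T \<otimes>\<^bsub>?G\<^esub> (B \<otimes>\<^bsub>?G\<^esub> P) \<otimes>\<^bsub>?G\<^esub> T" using T B P by (simp add: G.m_assoc)
    also have "\<dots> = (T \<otimes>\<^bsub>?G\<^esub> P) \<otimes>\<^bsub>?G\<^esub> inv\<^bsub>?G\<^esub> A" using T B P by (simp add: BP invA G.m_assoc)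
    finally show ?thesis
      unfolding S using T P A by (intro G.conj_by_eqI) auto
  qed
  \<comment> \<open>\<open>e\<close> is \<open>v 1 + v 2\<close> minus its projection \<open>u\<close> to the span of \<open>u\<close> and \<open>v 1\<close>.\<close>
  define e where "e = u + v 1 + v 2"
  have eV: "e \<in> V m" using m by (simp add: e_def V_closed)
  have e: "q m e = 0" "bil m u e = 0" "bil m (v 1) e = 0"
    using m by (simp_all add: e_def q_add bil_add bil_basis q_basis bil_alternating laurent_two
        bil_commute[of m _ u])
  have S1: "signed_perm m (Transposition.transpose 1 2) = eichler m e u"
  proof -
    have "u + e = v 1 + v 2" using vec_add_self[of u] by (simp add: e_def flip: add.assoc)
    then show ?thesis
      using m transvection_mult_eq_eichler[of u m e] e eV signed_perm_transpose[of 1 m 2]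
      by (simp add: V_closed q_basis)
  qed
  have SG: "eichler m e u \<in> carrier ?G"
    using e eV by (intro eichler_orthogonal) (simp_all add: V_closed q_basis)
  have "T e = e" "B e = e"
    using e eV by (simp_all add: T_def B_def transvection_apply bil_commute[of m e] scal_simps)
  then have "A \<in> {g \<in> carrier ?G. g e = e}"
    using A by (simp add: A_def orthogonal_mult_apply eV)
  then have Ak: "A [^]\<^bsub>?G\<^esub> k \<in> {g \<in> carrier ?G. g e = e}" for k :: int
    by (rule G.subgroup_int_pow_closed[OF stabiliser_subgroup[OF eV]])
  have comm: "commutator ?G (signed_perm m (Transposition.transpose 1 2))
      (conj_by ?G (signed_perm m (Transposition.transpose 1 2)) (A [^]\<^bsub>?G\<^esub> k)) = \<one>\<^bsub>?G\<^esub>" for k :: int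
  proof -
    define g where "g = A [^]\<^bsub>?G\<^esub> k"
    have g: "g \<in> carrier ?G" "g e = e" using Ak[of k] by (simp_all add: g_def)
    have gu: "g u \<in> V m" by (rule orthogonal_closed[OF g(1) V_closed(1)])
    have gue: "bil m (g u) e = 0"
      using orthogonal_bil[OF g(1) V_closed(1) eV] by (simp add: g e)
    have sg: "eichler m e u \<otimes>\<^bsub>?G\<^esub> g = g \<otimes>\<^bsub>?G\<^esub> eichler m e (g u)"
      using eichler_orthogonal_commute[OF g(1) eV V_closed(1)] by (simp add: g)
    have gG: "eichler m e (g u) \<in> carrier ?G"
      using gu eV gue e orthogonal_q[OF g(1) V_closed(1)]
      by (intro eichler_orthogonal) (simp_all add: q_basis)
    have E: "conj_by ?G (eichler m e u) g = eichler m e (g u)"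
      by (rule G.conj_by_eqI[OF SG gG g(1) sg])
    have "eichler m e u \<otimes>\<^bsub>?G\<^esub> eichler m e (g u) = eichler m e (g u) \<otimes>\<^bsub>?G\<^esub> eichler m e u"
      using e eV gu gue by (simp add: eichler_mult V_closed add.commute)
    then show ?thesis
      unfolding S1 g_def[symmetric] E using SG gG by (intro G.commutator_eq_one)
  qed
  obtain \<phi> where \<phi>: "\<phi> \<in> hom (yt_group m) ?G" "\<phi> (yt_tau m) = T" "\<phi> (yt_a m) = A"
    and \<phi>p: "\<And>p. p permutes {1..m} \<Longrightarrow> \<phi> (yt_incl m (y_perm m p)) = signed_perm m p"
    by (rule yt_group_universal[OF m group_orthogonal_group A signed_perm_hom comm conj T TA TS]) auto
  have "\<phi> (yt_s m i) = transvection m (v i + v (i + 1))" if i: "1 \<le> i" "i \<le> m - 1" for i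
  proof -
    define r where "r = transvection m (v i + v (i + 1))"
    have p: "Transposition.transpose i (i + 1) permutes {1..m}"
      using i m by (intro permutes_swap_id) auto
    have r: "r \<in> carrier ?G"
      using i m unfolding r_def by (intro transvection_orthogonal) (auto simp: V_closed q_v_add)
    have "yt_tau m \<in> carrier (yt_group m)"
      using group.is_monoid[OF group_y_group[OF m]]
      by (auto simp: yt_tau_def yt_group_def semidirect_def monoid.one_closed)
    moreover have "yt_incl m (y_s m i) \<in> carrier (yt_group m)"
      using y_perm_closed[OF m p] by (simp add: yt_incl_def y_s_def yt_group_def semidirect_def)
    ultimately have "\<phi> (yt_s m i) = T \<otimes>\<^bsub>?G\<^esub> signed_perm m (Transposition.transpose i (i + 1))"
      by (simp add: yt_s_def hom_mult[OF \<phi>(1)] \<phi>(2) y_s_def \<phi>p[OF p, simplified])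
    also have "\<dots> = T \<otimes>\<^bsub>?G\<^esub> (T \<otimes>\<^bsub>?G\<^esub> r)"
      using i m by (subst signed_perm_transpose) (auto simp: T_def r_def)
    also have "\<dots> = r" using T r by (simp flip: G.m_assoc)
    finally show ?thesis unfolding r_def .
  qed
  then show ?thesis using \<phi> unfolding A_def T_def B_def by blast
qed

end
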